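(* Let $\mathcal C$ be a braided monoidal category equipped with a class $\mathcal Q$ of regular epimorphisms satisfying the standing assumptions in the context. Let $(A,t_1,t_2,e)$ be a multiplier Hopf monoid in $\mathcal C$ whose multiplication $m=e1.t_1=1e.t_2$ is non-degenerate and whose counit is dense (that is, $e\in\mathcal Q$). Then its antipode $s$, the $\mathbb M$-morphism with components $s_1=e1.t_1^{-1}\colon A^2\to A$ and $s_2=1e.t_2^{-1}\colon A^2\to A$, is a morphism of multiplier bimonoids $$(A,\;c.t_2.c^{-1},\;c.t_1.c^{-1},\;e)\longrightarrow (A,t_1,t_2,e).$$
   Context: Notation: $\mathcal C$ is a braided monoidal category, written as if strict; the monoidal product (of objects and morphisms) is juxtaposition, the unit is $I$, the braiding is $c_{X,Y}\colon XY\to YX$. The composite of $f\colon A\to B$ and $g\colon B\to C$ is $g.f$ (juxtaposition binds more tightly than the dot); identity morphisms are written $1$; $A^n=A\cdots A$. Subscripts of $c$ are omitted; $c^{-1}\colon XY\to YX$ means $(c_{Y,X})^{-1}$. Standing assumptions: $\mathcal Q$ is a class of regular epimorphisms in $\mathcal C$, closed under composition and monoidal product, containing the isomorphisms, right-cancellative ($s\in\mathcal Q$ and $t.s\in\mathcal Q$ imply $t\in\mathcal Q$), and such that each $q\in \mathcal Q$ is the coequalizer of some pair of morphisms for which this coequalizer is preserved by taking the monoidal product with any fixed object. Semigroups: a semigroup $(A,m)$ is an object with $m\colon A^2\to A$ satisfying $m.m1=m.1m$. It is non-degenerate if for all objects $X,Y$ the maps $\mathcal C(X,YA)\to\mathcal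 C(XA,YA)$, $f\mapsto 1m.f1$, and $\mathcal C(X,AY)\to\mathcal C(AX,AY)$, $g\mapsto m1.1g$, are injective. $\mathbb M$-morphisms: for a non-degenerate semigroup $(B,m)$ and an object $A$, an $\mathbb M$-morphism $f\colon A\nrightarrow B$ is a pair of morphisms (components) $f_1\colon AB\to B$, $f_2\colon BA\to B$ with $m.1f_1=m.f_21\colon BAB\to B$. It is dense if $f_1,f_2\in\mathcal Q$. If $A$ is also a semigroup, $f$ is multiplicative if $f_1.1f_1=f_1.m1\colon A^2B\to B$ (equivalently $f_2.f_21=f_2.1m\colon BA^2\to B$). Multiplier bimonoid: $(A,t_1,t_2,e)$ with $t_1,t_2\colon A^2\to A^2$, $e\colon A\to I$ such that $t_11.c^{-1}1.1t_1.c1.1t_1=1t_1.t_11$ and $1e.t_1=1e$; $1t_2.1c^{-1}.t_21.1c.t_21=t_21.1t_2$ and $e1.t_2=e1$; $1t_1.t_21=t_21.1t_1$ and $e1.t_1=1e.t_2$. Its multiplication $m:=e1.t_1=1e.t_2$ is associative. It is a multiplier Hopf monoid if $t_1$ and $t_2$ are isomorphisms. For any multiplier bimonoid $(A,t_1,t_2,e)$, the tuple $(A,c.t_2.c^{-1},c.t_1.c^{-1},e)$ is again a multiplier bimonoid, with multiplication $m.c^{-1}$. (Under the hypotheses of the claim, $m$ and the morphisms $d_1=m1.c^{-1}1.1t_1.c1$, $d_2=1m.1c^{-1}.t_21.1c\colon A^3\to A^2$ also belong to $\mathcal Q$.) Morphisms: let $(A,t_1,t_2,e)$ and $(B,t_1,t_2,e)$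 be multiplier bimonoids with non-degenerate multiplication $m$ and with $m,e,d_1,d_2\in \mathcal Q$. A morphism of multiplier bimonoids from $A$ to $B$ is a dense multiplicative $\mathbb M$-morphism $f\colon A\nrightarrow B$ (with respect to the underlying semigroups) such that $e.f_1=ee\colon AB\to I$; $f_11.1t_1.1f_11=f_1f_1.1c1.t_2t_1\colon A^2B^2\to B^2$; $e.f_2=ee\colon BA\to I$; $1f_2.t_21.1f_21=f_2f_2.1c1.t_2t_1\colon B^2A^2\to B^2$, where each $t_i$ and $e$ is that of $A$ or $B$ according to the object on which it acts. *)

theory Defs
  imports Main
begin

section \<open>Braided monoidal categories\<close>

text \<open>
  A category is given by a set of objects and a set of arrows with domain and codomain maps;
  composition is a total function that is meaningful on composable arrows only.
  No strictness is assumed of the monoidal structure: in the formulas below, objects are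
  bracketed explicitly and the associativity and unit constraints are inserted accordingly.
  Tensor products of arrows bind more tightly than composition.
\<close>

record ('o, 'm) category =
  Obj :: "'o set"
  Arr :: "'m set"
  Dom :: "'m \<Rightarrow> 'o"
  Cod :: "'m \<Rightarrow> 'o"
  ident :: "'o \<Rightarrow> 'm"  ("\<one>\<index>")
  comp :: "'m \<Rightarrow> 'm \<Rightarrow> 'm"  (infixr "\<cdot>\<index>" 70)

record ('o, 'm) monoidal_category = "('o, 'm) category" +
  tensor_obj :: "'o \<Rightarrow> 'o \<Rightarrow> 'o"  (infixr "\<odot>\<index>" 75)
  tensor_arr :: "'m \<Rightarrow> 'm \<Rightarrow> 'm"  (infixr "\<otimes>\<index>" 75)
  unit_obj :: 'o  ("\<I>\<index>")
  assoc :: "'o \<Rightarrow> 'o \<Rightarrow> 'o \<Rightarrow> 'm"  ("\<a>\<index>")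
  lunit :: "'o \<Rightarrow> 'm"  ("\<l>\<index>")
  runit :: "'o \<Rightarrow> 'm"  ("\<r>\<index>")

record ('o, 'm) braided_monoidal_category = "('o, 'm) monoidal_category" +
  braid :: "'o \<Rightarrow> 'o \<Rightarrow> 'm"  ("\<c>\<index>")

definition hom :: "('o, 'm, 'z) category_scheme \<Rightarrow> 'o \<Rightarrow> 'o \<Rightarrow> 'm set" where
  "hom C X Y = {f \<in> Arr C. Dom C f = X \<and> Cod C f = Y}"

context
  fixes C :: "('o, 'm, 'z) category_scheme" (structure)
begin

definition inverse_arrows :: "'m \<Rightarrow> 'm \<Rightarrow> bool" where
  "inverse_arrows f g \<longleftrightarrow>
     f \<in> Arr C \<and> g \<in> hom C (Cod C f) (Dom C f) \<and>
     g \<cdot> f = \<one> (Dom C f) \<and> f \<cdot> g = \<one> (Cod C f)"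

definition iso :: "'m \<Rightarrow> bool" where
  "iso f \<longleftrightarrow> (\<exists>g. inverse_arrows f g)"

definition inverse_arr :: "'m \<Rightarrow> 'm" where
  "inverse_arr f = (THE g. inverse_arrows f g)"

definition is_coequalizer :: "'m \<Rightarrow> 'm \<Rightarrow> 'm \<Rightarrow> bool" where
  "is_coequalizer f g q \<longleftrightarrow>
     f \<in> Arr C \<and> g \<in> Arr C \<and> q \<in> Arr C \<and>
     Dom C f = Dom C g \<and> Cod C f = Cod C g \<and> Cod C f = Dom C q \<and>
     q \<cdot> f = q \<cdot> g \<and>
     (\<forall>h \<in> Arr C. Dom C h = Cod C f \<longrightarrow> h \<cdot> f = h \<cdot> g \<longrightarrow>
        (\<exists>!k. k \<in> hom C (Cod C q) (Cod C h) \<and> k \<cdot> q = h))"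

definition regular_epi :: "'m \<Rightarrow> bool" where
  "regular_epi q \<longleftrightarrow> (\<exists>f g. is_coequalizer f g q)"

end

definition inv_assoc :: "('o, 'm, 'z) monoidal_category_scheme \<Rightarrow> 'o \<Rightarrow> 'o \<Rightarrow> 'o \<Rightarrow> 'm"
    ("\<a>\<^sup>-\<index>") where
  "inv_assoc C X Y Z = inverse_arr C (assoc C X Y Z)"

text \<open>Like the braiding itself, its inverse is indexed by its domain: \<open>\<c>\<^sup>- X Y\<close> is the arrow
  from \<open>X \<odot> Y\<close> to \<open>Y \<odot> X\<close> inverse to \<open>\<c> Y X\<close>.\<close>

definition inv_braid :: "('o, 'm, 'z) braided_monoidal_category_scheme \<Rightarrow> 'o \<Rightarrow> 'o \<Rightarrow> 'm"
    ("\<c>\<^sup>-\<index>") where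
  "inv_braid C X Y = inverse_arr C (braid C Y X)"

locale category =
  fixes C (structure)
  assumes dom_obj: "f \<in> Arr C \<Longrightarrow> Dom C f \<in> Obj C"
    and cod_obj: "f \<in> Arr C \<Longrightarrow> Cod C f \<in> Obj C"
    and ident_hom: "X \<in> Obj C \<Longrightarrow> \<one> X \<in> hom C X X"
    and comp_hom: "f \<in> hom C X Y \<Longrightarrow> g \<in> hom C Y Z \<Longrightarrow> g \<cdot> f \<in> hom C X Z"
    and comp_ident_right: "f \<in> hom C X Y \<Longrightarrow> f \<cdot> \<one> X = f"
    and comp_ident_left: "f \<in> hom C X Y \<Longrightarrow> \<one> Y \<cdot> f = f"
    and comp_assoc: "f \<in> hom C W X \<Longrightarrow> g \<in> hom C X Y \<Longrightarrow> h \<in> hom C Y Z \<Longrightarrow>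
      (h \<cdot> g) \<cdot> f = h \<cdot> (g \<cdot> f)"

locale monoidal_category = category +
  assumes tensor_obj: "X \<in> Obj C \<Longrightarrow> Y \<in> Obj C \<Longrightarrow> X \<odot> Y \<in> Obj C"
    and unit_obj: "\<I> \<in> Obj C"
    and tensor_hom: "f \<in> hom C X X' \<Longrightarrow> g \<in> hom C Y Y' \<Longrightarrow>
      f \<otimes> g \<in> hom C (X \<odot> Y) (X' \<odot> Y')"
    and tensor_ident: "X \<in> Obj C \<Longrightarrow> Y \<in> Obj C \<Longrightarrow> \<one> X \<otimes> \<one> Y = \<one> (X \<odot> Y)"
    and tensor_comp: "f \<in> hom C X X' \<Longrightarrow> f' \<in> hom C X' X'' \<Longrightarrow>
      g \<in> hom C Y Y' \<Longrightarrow> g' \<in> hom C Y' Y'' \<Longrightarrow>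
      (f' \<cdot> f) \<otimes> (g' \<cdot> g) = f' \<otimes> g' \<cdot> f \<otimes> g"
    and assoc_hom: "X \<in> Obj C \<Longrightarrow> Y \<in> Obj C \<Longrightarrow> Z \<in> Obj C \<Longrightarrow>
      \<a> X Y Z \<in> hom C ((X \<odot> Y) \<odot> Z) (X \<odot> (Y \<odot> Z))"
    and assoc_iso: "X \<in> Obj C \<Longrightarrow> Y \<in> Obj C \<Longrightarrow> Z \<in> Obj C \<Longrightarrow> iso C (\<a> X Y Z)"
    and assoc_natural: "f \<in> hom C X X' \<Longrightarrow> g \<in> hom C Y Y' \<Longrightarrow> h \<in> hom C Z Z' \<Longrightarrow>
      \<a> X' Y' Z' \<cdot> (f \<otimes> g) \<otimes> h = f \<otimes> (g \<otimes> h) \<cdot> \<a> X Y Z"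
    and lunit_hom: "X \<in> Obj C \<Longrightarrow> \<l> X \<in> hom C (\<I> \<odot> X) X"
    and lunit_iso: "X \<in> Obj C \<Longrightarrow> iso C (\<l> X)"
    and lunit_natural: "f \<in> hom C X Y \<Longrightarrow> \<l> Y \<cdot> \<one> \<I> \<otimes> f = f \<cdot> \<l> X"
    and runit_hom: "X \<in> Obj C \<Longrightarrow> \<r> X \<in> hom C (X \<odot> \<I>) X"
    and runit_iso: "X \<in> Obj C \<Longrightarrow> iso C (\<r> X)"
    and runit_natural: "f \<in> hom C X Y \<Longrightarrow> \<r> Y \<cdot> f \<otimes> \<one> \<I> = f \<cdot> \<r> X"
    and pentagon: "W \<in> Obj C \<Longrightarrow> X \<in> Obj C \<Longrightarrow> Y \<in> Obj C \<Longrightarrow> Z \<in> Obj C \<Longrightarrow>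
      \<one> W \<otimes> \<a> X Y Z \<cdot> \<a> W (X \<odot> Y) Z \<cdot> \<a> W X Y \<otimes> \<one> Z = \<a> W X (Y \<odot> Z) \<cdot> \<a> (W \<odot> X) Y Z"
    and triangle: "X \<in> Obj C \<Longrightarrow> Y \<in> Obj C \<Longrightarrow>
      \<one> X \<otimes> \<l> Y \<cdot> \<a> X \<I> Y = \<r> X \<otimes> \<one> Y"

locale braided_monoidal_category = monoidal_category +
  assumes braid_hom: "X \<in> Obj C \<Longrightarrow> Y \<in> Obj C \<Longrightarrow> \<c> X Y \<in> hom C (X \<odot> Y) (Y \<odot> X)"
    and braid_iso: "X \<in> Obj C \<Longrightarrow> Y \<in> Obj C \<Longrightarrow> iso C (\<c> X Y)"
    and braid_natural: "f \<in> hom C X X' \<Longrightarrow> g \<in> hom C Y Y' \<Longrightarrow>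
      \<c> X' Y' \<cdot> f \<otimes> g = g \<otimes> f \<cdot> \<c> X Y"
    and hexagon: "X \<in> Obj C \<Longrightarrow> Y \<in> Obj C \<Longrightarrow> Z \<in> Obj C \<Longrightarrow>
      \<a> Y Z X \<cdot> \<c> X (Y \<odot> Z) \<cdot> \<a> X Y Z = \<one> Y \<otimes> \<c> X Z \<cdot> \<a> Y X Z \<cdot> \<c> X Y \<otimes> \<one> Z"
    and hexagon': "X \<in> Obj C \<Longrightarrow> Y \<in> Obj C \<Longrightarrow> Z \<in> Obj C \<Longrightarrow>
      \<a>\<^sup>- Z X Y \<cdot> \<c> (X \<odot> Y) Z \<cdot> \<a>\<^sup>- X Y Z = \<c> X Z \<otimes> \<one> Y \<cdot> \<a>\<^sup>- X Z Y \<cdot> \<one> X \<otimes> \<c> Y Z"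

section \<open>The class of dense morphisms\<close>

locale regular_epi_class = monoidal_category +
  fixes Q
  assumes arr: "q \<in> Q \<Longrightarrow> q \<in> Arr C"
    and regular_epi: "q \<in> Q \<Longrightarrow> regular_epi C q"
    and comp_closed: "p \<in> Q \<Longrightarrow> q \<in> Q \<Longrightarrow> Dom C q = Cod C p \<Longrightarrow> q \<cdot> p \<in> Q"
    and tensor_closed: "p \<in> Q \<Longrightarrow> q \<in> Q \<Longrightarrow> p \<otimes> q \<in> Q"
    and isos: "iso C q \<Longrightarrow> q \<in> Q"
    and right_cancel: "s \<in> Q \<Longrightarrow> t \<in> Arr C \<Longrightarrow> Dom C t = Cod C s \<Longrightarrow> t \<cdot> s \<in> Q \<Longrightarrow> t \<in> Q"
    and preserved_coequalizer: "q \<in> Q \<Longrightarrow>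
      \<exists>f g. is_coequalizer C f g q \<and>
        (\<forall>X \<in> Obj C. is_coequalizer C (\<one> X \<otimes> f) (\<one> X \<otimes> g) (\<one> X \<otimes> q) \<and>
                     is_coequalizer C (f \<otimes> \<one> X) (g \<otimes> \<one> X) (q \<otimes> \<one> X))"

section \<open>Semigroups and M-morphisms\<close>

context
  fixes C :: "('o, 'm, 'z) braided_monoidal_category_scheme" (structure)
begin

definition semigroup :: "'o \<Rightarrow> 'm \<Rightarrow> bool" where
  "semigroup A m \<longleftrightarrow>
     A \<in> Obj C \<and> m \<in> hom C (A \<odot> A) A \<and>
     m \<cdot> m \<otimes> \<one> A = m \<cdot> \<one> A \<otimes> m \<cdot> \<a> A A A"

definition nondegenerate :: "'o \<Rightarrow> 'm \<Rightarrow> bool" where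
  "nondegenerate A m \<longleftrightarrow>
     (\<forall>X \<in> Obj C. \<forall>Y \<in> Obj C.
        inj_on (\<lambda>f. \<one> Y \<otimes> m \<cdot> \<a> Y A A \<cdot> f \<otimes> \<one> A) (hom C X (Y \<odot> A)) \<and>
        inj_on (\<lambda>g. m \<otimes> \<one> Y \<cdot> \<a>\<^sup>- A A Y \<cdot> \<one> A \<otimes> g) (hom C X (A \<odot> Y)))"

definition M_morphism :: "'o \<Rightarrow> 'o \<Rightarrow> 'm \<Rightarrow> 'm \<Rightarrow> 'm \<Rightarrow> bool" where
  "M_morphism A B m f1 f2 \<longleftrightarrow>
     A \<in> Obj C \<and> semigroup B m \<and> nondegenerate B m \<and>
     f1 \<in> hom C (A \<odot> B) B \<and> f2 \<in> hom C (B \<odot> A) B \<and>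
     m \<cdot> \<one> B \<otimes> f1 \<cdot> \<a> B A B = m \<cdot> f2 \<otimes> \<one> B"

definition dense_M_morphism :: "'m set \<Rightarrow> 'o \<Rightarrow> 'o \<Rightarrow> 'm \<Rightarrow> 'm \<Rightarrow> 'm \<Rightarrow> bool" where
  "dense_M_morphism Q A B m f1 f2 \<longleftrightarrow> M_morphism A B m f1 f2 \<and> f1 \<in> Q \<and> f2 \<in> Q"

definition multiplicative_M_morphism ::
    "'o \<Rightarrow> 'm \<Rightarrow> 'o \<Rightarrow> 'm \<Rightarrow> 'm \<Rightarrow> 'm \<Rightarrow> bool" where
  "multiplicative_M_morphism A mA B mB f1 f2 \<longleftrightarrow>
     semigroup A mA \<and> M_morphism A B mB f1 f2 \<and>
     f1 \<cdot> \<one> A \<otimes> f1 \<cdot> \<a> A A B = f1 \<cdot> mA \<otimes> \<one> B"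

section \<open>Multiplier bimonoids and multiplier Hopf monoids\<close>

definition mult :: "'o \<Rightarrow> 'm \<Rightarrow> 'm \<Rightarrow> 'm" where
  "mult A t1 e = \<l> A \<cdot> e \<otimes> \<one> A \<cdot> t1"

definition multiplier_bimonoid :: "'o \<Rightarrow> 'm \<Rightarrow> 'm \<Rightarrow> 'm \<Rightarrow> bool" where
  "multiplier_bimonoid A t1 t2 e \<longleftrightarrow>
     A \<in> Obj C \<and> t1 \<in> hom C (A \<odot> A) (A \<odot> A) \<and> t2 \<in> hom C (A \<odot> A) (A \<odot> A) \<and>
     e \<in> hom C A \<I> \<and>
     t1 \<otimes> \<one> A \<cdot> \<c>\<^sup>- A A \<otimes> \<one> A \<cdot> \<a>\<^sup>- A A A \<cdot> \<one> A \<otimes> t1 \<cdot> \<a> A A A \<cdot>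
         \<c> A A \<otimes> \<one> A \<cdot> \<a>\<^sup>- A A A \<cdot> \<one> A \<otimes> t1
       = \<a>\<^sup>- A A A \<cdot> \<one> A \<otimes> t1 \<cdot> \<a> A A A \<cdot> t1 \<otimes> \<one> A \<cdot> \<a>\<^sup>- A A A \<and>
     \<r> A \<cdot> \<one> A \<otimes> e \<cdot> t1 = \<r> A \<cdot> \<one> A \<otimes> e \<and>
     \<one> A \<otimes> t2 \<cdot> \<one> A \<otimes> \<c>\<^sup>- A A \<cdot> \<a> A A A \<cdot> t2 \<otimes> \<one> A \<cdot> \<a>\<^sup>- A A A \<cdot>
         \<one> A \<otimes> \<c> A A \<cdot> \<a> A A A \<cdot> t2 \<otimes> \<one> A
       = \<a> A A A \<cdot> t2 \<otimes> \<one> A \<cdot> \<a>\<^sup>- A A A \<cdot> \<one> A \<otimes> t2 \<cdot> \<a> A A A \<and>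
     \<l> A \<cdot> e \<otimes> \<one> A \<cdot> t2 = \<l> A \<cdot> e \<otimes> \<one> A \<and>
     \<one> A \<otimes> t1 \<cdot> \<a> A A A \<cdot> t2 \<otimes> \<one> A
       = \<a> A A A \<cdot> t2 \<otimes> \<one> A \<cdot> \<a>\<^sup>- A A A \<cdot> \<one> A \<otimes> t1 \<cdot> \<a> A A A \<and>
     \<l> A \<cdot> e \<otimes> \<one> A \<cdot> t1 = \<r> A \<cdot> \<one> A \<otimes> e \<cdot> t2"

definition multiplier_hopf_monoid :: "'o \<Rightarrow> 'm \<Rightarrow> 'm \<Rightarrow> 'm \<Rightarrow> bool" where
  "multiplier_hopf_monoid A t1 t2 e \<longleftrightarrow>
     multiplier_bimonoid A t1 t2 e \<and> iso C t1 \<and> iso C t2"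

definition antipode1 :: "'o \<Rightarrow> 'm \<Rightarrow> 'm \<Rightarrow> 'm" where
  "antipode1 A t1 e = \<l> A \<cdot> e \<otimes> \<one> A \<cdot> inverse_arr C t1"

definition antipode2 :: "'o \<Rightarrow> 'm \<Rightarrow> 'm \<Rightarrow> 'm" where
  "antipode2 A t2 e = \<r> A \<cdot> \<one> A \<otimes> e \<cdot> inverse_arr C t2"

section \<open>Morphisms of multiplier bimonoids\<close>

text \<open>The bracketings used are \<open>d1 : (A \<odot> A) \<odot> A \<rightarrow> A \<odot> A\<close> and
  \<open>d2 : A \<odot> (A \<odot> A) \<rightarrow> A \<odot> A\<close>; membership in a class of morphisms that contains the
  isomorphisms and is closed under composition does not depend on this choice.\<close>

definition d1 :: "'o \<Rightarrow> 'm \<Rightarrow> 'm \<Rightarrow> 'm" where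
  "d1 A t1 e = mult A t1 e \<otimes> \<one> A \<cdot> \<c>\<^sup>- A A \<otimes> \<one> A \<cdot> \<a>\<^sup>- A A A \<cdot>
     \<one> A \<otimes> t1 \<cdot> \<a> A A A \<cdot> \<c> A A \<otimes> \<one> A"

definition d2 :: "'o \<Rightarrow> 'm \<Rightarrow> 'm \<Rightarrow> 'm \<Rightarrow> 'm" where
  "d2 A t1 t2 e = \<one> A \<otimes> mult A t1 e \<cdot> \<one> A \<otimes> \<c>\<^sup>- A A \<cdot> \<a> A A A \<cdot>
     t2 \<otimes> \<one> A \<cdot> \<a>\<^sup>- A A A \<cdot> \<one> A \<otimes> \<c> A A"

text \<open>The multiplier bimonoids between which morphisms are defined.\<close>

definition admissible_bimonoid :: "'m set \<Rightarrow> 'o \<Rightarrow> 'm \<Rightarrow> 'm \<Rightarrow> 'm \<Rightarrow> bool" where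
  "admissible_bimonoid Q A t1 t2 e \<longleftrightarrow>
     multiplier_bimonoid A t1 t2 e \<and> nondegenerate A (mult A t1 e) \<and>
     mult A t1 e \<in> Q \<and> e \<in> Q \<and> d1 A t1 e \<in> Q \<and> d2 A t1 t2 e \<in> Q"

text \<open>The arrow \<open>1c1 : (W \<odot> X) \<odot> (Y \<odot> Z) \<rightarrow> (W \<odot> Y) \<odot> (X \<odot> Z)\<close>.\<close>

definition mid_braid :: "'o \<Rightarrow> 'o \<Rightarrow> 'o \<Rightarrow> 'o \<Rightarrow> 'm" where
  "mid_braid W X Y Z =
     \<a>\<^sup>- W Y (X \<odot> Z) \<cdot>
     \<one> W \<otimes> (\<a> Y X Z \<cdot> \<c> X Y \<otimes> \<one> Z \<cdot> \<a>\<^sup>- X Y Z) \<cdot>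
     \<a> W X (Y \<odot> Z)"

text \<open>The two comultiplicativity axioms below are equations between arrows
  \<open>(A \<odot> A) \<odot> (B \<odot> B) \<rightarrow> B \<odot> B\<close> and \<open>(B \<odot> B) \<odot> (A \<odot> A) \<rightarrow> B \<odot> B\<close>.\<close>

definition bimonoid_morphism ::
    "'m set \<Rightarrow> 'o \<Rightarrow> 'm \<Rightarrow> 'm \<Rightarrow> 'm \<Rightarrow> 'o \<Rightarrow> 'm \<Rightarrow> 'm \<Rightarrow> 'm \<Rightarrow> 'm \<Rightarrow> 'm \<Rightarrow> bool" where
  "bimonoid_morphism Q A t1A t2A eA B t1B t2B eB f1 f2 \<longleftrightarrow>
     admissible_bimonoid Q A t1A t2A eA \<and> admissible_bimonoid Q B t1B t2B eB \<and>
     dense_M_morphism Q A B (mult B t1B eB) f1 f2 \<and>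
     multiplicative_M_morphism A (mult A t1A eA) B (mult B t1B eB) f1 f2 \<and>
     eB \<cdot> f1 = \<l> \<I> \<cdot> eA \<otimes> eB \<and>
     f1 \<otimes> \<one> B \<cdot> \<a>\<^sup>- A B B \<cdot> \<one> A \<otimes> t1B \<cdot> \<one> A \<otimes> (f1 \<otimes> \<one> B) \<cdot>
         \<one> A \<otimes> \<a>\<^sup>- A B B \<cdot> \<a> A A (B \<odot> B)
       = f1 \<otimes> f1 \<cdot> mid_braid A A B B \<cdot> t2A \<otimes> t1B \<and>
     eB \<cdot> f2 = \<l> \<I> \<cdot> eB \<otimes> eA \<and>
     \<one> B \<otimes> f2 \<cdot> \<a> B B A \<cdot> t2B \<otimes> \<one> A \<cdot> \<a>\<^sup>- B B A \<cdot> \<one> B \<otimes> (f2 \<otimes> \<one> A) \<cdot>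
         \<one> B \<otimes> \<a>\<^sup>- B A A \<cdot> \<a> B B (A \<odot> A)
       = f2 \<otimes> f2 \<cdot> mid_braid B B A A \<cdot> t2B \<otimes> t1A"

end

end

theory Submission
  imports Defs
begin

text \<open>
  In string diagram notation, write $T_i$ for $t_1$ and $s_i$ for $s_1$ applied to the strands
  $i, i+1$. The definition of the antipode amounts to $s_1 . t_1 = e1$, and each axiom of a
  morphism can be checked after composition with suitable isomorphisms $T_i$ and $c_i$, where this
  equation eliminates the antipode. For comultiplicativity one composes with $T_2$, rewrites
  $T_3 T_2$ by the fusion equation, and slides the antipode through the braiding using
  $s_2 T_1 c_1^{-1} T_2 = s_2 c_1^{-1}$.

  These calculations involve tensor powers of $A$ only. They are carried out in a strict braided
  monoidal category with objects the natural numbers; the powers of $A$ form such a category, and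
  equations between bracketed arrows are equivalent to their strict versions.
\<close>

section \<open>String diagrams\<close>

text \<open>Mirror symmetry saves half of the work. Reversing the order of the tensor product, and
  using \<open>br n m\<close> as the braiding of m and n, gives a braided category again, in which
  \<open>t1\<close> and \<open>t2\<close>, and hence the two components of the antipode, have
  changed places. In a strict category this reversal costs nothing, whereas in \<open>C\<close> it
  would replace every constraint by an inverse. The opposite bimonoid is a different matter: it is
  conjugate to the mirror image by \<open>c\<close>, and its axioms on three strands need a braid
  that permutes all three of them. Two ingredients cannot be moved to the strict category.
  Non-degeneracy quantifies over all objects X and Y, not only over powers of \<open>A\<close>, so
  its invariance under passage to the opposite multiplication is proved in \<open>C\<close> with
  explicit associativity constraints. Membership in \<open>Q\<close> concerns arrows of
  \<open>C\<close>; there the invertibility of \<open>t1\<close> and \<open>t2\<close> reduces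
  everything to the density of \<open>e\<close>.\<close>

declare One_nat_def [simp del]

text \<open>Associativity of composition is required without typing conditions: arrows that do not
  compose have an error value as their composite.\<close>

locale pro =
  fixes arr :: "'a \<Rightarrow> bool" and dm cd :: "'a \<Rightarrow> nat"
    and idn :: "nat \<Rightarrow> 'a"
    and cmp :: "'a \<Rightarrow> 'a \<Rightarrow> 'a"  (infixr "\<bullet>" 70)
    and tns :: "'a \<Rightarrow> 'a \<Rightarrow> 'a"  (infixr "\<boxtimes>" 75)
  assumes idn [simp]: "arr (idn n)" "dm (idn n) = n" "cd (idn n) = n"
    and cmp [simp]: "arr f \<Longrightarrow> arr g \<Longrightarrow> dm g = cd f \<Longrightarrow> arr (g \<bullet> f)"
      "arr f \<Longrightarrow> arr g \<Longrightarrow> dm g = cd f \<Longrightarrow> dm (g \<bullet> f) = dm f"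
      "arr f \<Longrightarrow> arr g \<Longrightarrow> dm g = cd f \<Longrightarrow> cd (g \<bullet> f) = cd g"
    and cmp_assoc: "(h \<bullet> g) \<bullet> f = h \<bullet> g \<bullet> f"
    and cmp_idn [simp]: "arr f \<Longrightarrow> dm f = n \<Longrightarrow> f \<bullet> idn n = f"
      "arr f \<Longrightarrow> cd f = n \<Longrightarrow> idn n \<bullet> f = f"
    and tns [simp]: "arr f \<Longrightarrow> arr g \<Longrightarrow> arr (f \<boxtimes> g)"
      "arr f \<Longrightarrow> arr g \<Longrightarrow> dm (f \<boxtimes> g) = dm f + dm g"
      "arr f \<Longrightarrow> arr g \<Longrightarrow> cd (f \<boxtimes> g) = cd f + cd g"
    and tns_assoc: "arr f \<Longrightarrow> arr g \<Longrightarrow> arr h \<Longrightarrow> (f \<boxtimes> g) \<boxtimes> h = f \<boxtimes> g \<boxtimes> h"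
    and tns_idn: "idn m \<boxtimes> idn n = idn (m + n)"
    and tns_unit [simp]: "arr f \<Longrightarrow> idn 0 \<boxtimes> f = f" "arr f \<Longrightarrow> f \<boxtimes> idn 0 = f"
    and tns_cmp: "arr f \<Longrightarrow> arr f' \<Longrightarrow> arr g \<Longrightarrow> arr g' \<Longrightarrow> dm f' = cd f \<Longrightarrow> dm g' = cd g \<Longrightarrow>
      (f' \<bullet> f) \<boxtimes> (g' \<bullet> g) = f' \<boxtimes> g' \<bullet> f \<boxtimes> g"
begin

lemma cmp_cong: "f = g \<Longrightarrow> f \<bullet> h = g \<bullet> h"
  by simp

lemma cmp_cong2: "f' \<bullet> f = g \<Longrightarrow> f' \<bullet> f \<bullet> h = g \<bullet> h"
  by (simp flip: cmp_assoc)

text \<open>Applied with \<open>p\<close> a composite of invertible generators; \<open>q\<close> is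
  then the composite of their inverses in the opposite order.\<close>

lemma cancel_split_epi:
  assumes "f \<bullet> p = g \<bullet> p" "p \<bullet> q = idn n" "arr f" "arr g" "dm f = n" "dm g = n"
  shows "f = g"
proof -
  have "f \<bullet> p \<bullet> q = g \<bullet> p \<bullet> q"
    using assms(1) by (simp flip: cmp_assoc)
  with assms show ?thesis
    by simp
qed

text \<open>Whiskering turns a diagram into a sequence of layers with one generator each, so that
  equations can be applied by rewriting composites. The strands are counted from 0 here:
  \<open>wh i t1 j\<close> acts on strands i+1 and i+2 of the overview.\<close>

definition wh :: "nat \<Rightarrow> 'a \<Rightarrow> nat \<Rightarrow> 'a" where
  "wh i f j = idn i \<boxtimes> f \<boxtimes> idn j"

lemma wh [simp]:
  assumes "arr f"
  shows "arr (wh i f j)" "dm (wh i f j) = i + dm f + j" "cd (wh i f j) = i + cd f + j"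
  using assms by (simp_all add: wh_def)

lemma wh_cmp: "arr f \<Longrightarrow> arr g \<Longrightarrow> dm g = cd f \<Longrightarrow> wh i (g \<bullet> f) j = wh i g j \<bullet> wh i f j"
  using tns_cmp[of "idn i" "idn i" "f \<boxtimes> idn j" "g \<boxtimes> idn j"] tns_cmp[of f g "idn j" "idn j"]
  by (simp add: wh_def)

lemma wh_idn [simp]: "wh i (idn n) j = idn (i + n + j)"
  by (simp add: wh_def tns_idn add.assoc)

lemma wh_wh [simp]: "arr f \<Longrightarrow> wh i (wh k f l) j = wh (i + k) f (l + j)"
  by (simp add: wh_def tns_assoc flip: tns_idn)

lemma wh_0_0 [simp]: "arr f \<Longrightarrow> wh 0 f 0 = f"
  by (simp add: wh_def)

lemma tns_idn_wh: "arr f \<Longrightarrow> f \<boxtimes> idn j = wh 0 f j" "arr f \<Longrightarrow> idn i \<boxtimes> f = wh i f 0"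
  by (simp_all add: wh_def)

lemma tns_wh: "arr f \<Longrightarrow> arr g \<Longrightarrow> f \<boxtimes> g = wh 0 f (cd g) \<bullet> wh (dm f) g 0"
  using tns_cmp[of "idn (dm f)" f g "idn (cd g)"] by (simp add: wh_def)

lemma tns_wh': "arr f \<Longrightarrow> arr g \<Longrightarrow> f \<boxtimes> g = wh (cd f) g 0 \<bullet> wh 0 f (dm g)"
  using tns_cmp[of f "idn (cd f)" "idn (dm g)" g] by (simp add: wh_def)

text \<open>Two generators on disjoint strands, with \<open>k\<close> idle strands between them, can
  be performed in either order. The offsets are separate variables tied by equations so that
  numerals match and the arithmetic is left to the simplifier.\<close>

lemma exchange:
  assumes "arr f" "arr g" "i' = i + dm f + k" "i'' = i + cd f + k"
    "j' = k + cd g + j" "j'' = k + dm g + j"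
  shows "wh i f j' \<bullet> wh i' g j = wh i'' g j \<bullet> wh i f j''"
proof -
  have "wh 0 f (k + cd g) \<bullet> wh (dm f + k) g 0 = wh (cd f + k) g 0 \<bullet> wh 0 f (k + dm g)"
    using tns_wh[of f "wh k g 0"] tns_wh'[of f "wh k g 0"] assms(1,2) by simp
  then have "wh i (wh 0 f (k + cd g) \<bullet> wh (dm f + k) g 0) j
      = wh i (wh (cd f + k) g 0 \<bullet> wh 0 f (k + dm g)) j"
    by simp
  with assms show ?thesis
    by (simp add: wh_cmp add.assoc)
qed

end

section \<open>Braids on numbered strands and the half twist\<close>

locale braided_pro = pro +
  fixes br bri :: "nat \<Rightarrow> nat \<Rightarrow> 'a"
  assumes br [simp]: "arr (br m n)" "dm (br m n) = m + n" "cd (br m n) = n + m"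
    and bri [simp]: "arr (bri m n)" "dm (bri m n) = m + n" "cd (bri m n) = n + m"
    and br_bri: "br m n \<bullet> bri n m = idn (n + m)"
    and bri_br: "bri n m \<bullet> br m n = idn (m + n)"
    and br_natural: "arr f \<Longrightarrow> arr g \<Longrightarrow>
      br (cd f) (cd g) \<bullet> f \<boxtimes> g = g \<boxtimes> f \<bullet> br (dm f) (dm g)"
    and br_add_right: "br l (m + n) = idn m \<boxtimes> br l n \<bullet> br l m \<boxtimes> idn n"
    and br_add_left: "br (l + m) n = br l n \<boxtimes> idn m \<bullet> idn l \<boxtimes> br m n"
begin

text \<open>The hexagon with two empty blocks makes \<open>br m 0\<close> idempotent, and an
  invertible idempotent is an identity.\<close>

lemma br_0_right: "br m 0 = idn m"
proof -
  have "br m 0 = br m 0 \<bullet> br m 0"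
    using br_add_right[of m 0 0] by simp
  then have "bri 0 m \<bullet> br m 0 = bri 0 m \<bullet> (br m 0 \<bullet> br m 0)"
    by simp
  then show ?thesis
    by (simp add: bri_br flip: cmp_assoc)
qed

lemma br_0_left: "br 0 m = idn m"
proof -
  have "br 0 m = br 0 m \<bullet> br 0 m"
    using br_add_left[of 0 0 m] by simp
  then have "bri m 0 \<bullet> br 0 m = bri m 0 \<bullet> (br 0 m \<bullet> br 0 m)"
    by simp
  then show ?thesis
    by (simp add: bri_br flip: cmp_assoc)
qed

abbreviation "c \<equiv> br 1 1"
abbreviation "ci \<equiv> bri 1 1"

lemma wh_c_ci: "wh i c j \<bullet> wh i ci j = idn (i + 2 + j)" "wh i ci j \<bullet> wh i c j = idn (i + 2 + j)"
  by (simp_all add: br_bri bri_br flip: wh_cmp)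

lemma wh_c_ci_assoc:
  "arr h \<Longrightarrow> cd h = i + 2 + j \<Longrightarrow> wh i c j \<bullet> wh i ci j \<bullet> h = h"
  "arr h \<Longrightarrow> cd h = i + 2 + j \<Longrightarrow> wh i ci j \<bullet> wh i c j \<bullet> h = h"
  by (simp_all add: wh_c_ci flip: cmp_assoc)

text \<open>Naturality of the braiding at \<open>e\<close>: a crossing disappears when one of its
  strands ends, because braiding with no strands is trivial.\<close>

lemma c_discard: "arr e \<Longrightarrow> dm e = 1 \<Longrightarrow> cd e = 0 \<Longrightarrow> wh 1 e 0 \<bullet> c = wh 0 e 1"
  "arr e \<Longrightarrow> dm e = 1 \<Longrightarrow> cd e = 0 \<Longrightarrow> wh 0 e 1 \<bullet> c = wh 1 e 0"
  using br_natural[of e "idn 1"] br_natural[of "idn 1" e]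
  by (simp_all add: tns_idn_wh br_0_left br_0_right)

lemma ci_discard:
  assumes "arr e" "dm e = 1" "cd e = 0"
  shows "wh 1 e 0 \<bullet> ci = wh 0 e 1" "wh 0 e 1 \<bullet> ci = wh 1 e 0"
  using c_discard(2)[OF assms, THEN cmp_cong, of ci] c_discard(1)[OF assms, THEN cmp_cong, of ci] assms
  by (simp_all add: cmp_assoc br_bri)

text \<open>Naturality with \<open>br 1 2\<close> split into two crossings. The number of outputs of
  \<open>g\<close> is left open: it is 2 for \<open>t1\<close> and \<open>t2\<close>, and 1 for
  \<open>s1\<close>.\<close>

lemma c_left: "arr g \<Longrightarrow> dm g = 2 \<Longrightarrow>
  br 1 (cd g) \<bullet> wh 1 g 0 = wh 0 g 1 \<bullet> wh 1 c 0 \<bullet> wh 0 c 1"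
  using br_natural[of "idn 1" g] br_add_right[of 1 1 1]
  by (simp add: tns_idn_wh)

lemma c_right: "arr g \<Longrightarrow> dm g = 2 \<Longrightarrow>
  br (cd g) 1 \<bullet> wh 0 g 1 = wh 1 g 0 \<bullet> wh 0 c 1 \<bullet> wh 1 c 0"
  using br_natural[of g "idn 1"] br_add_left[of 1 1 1]
  by (simp add: tns_idn_wh)

lemma c_left_2: "arr g \<Longrightarrow> dm g = 2 \<Longrightarrow> cd g = 2 \<Longrightarrow>
  wh 1 c 0 \<bullet> wh 0 c 1 \<bullet> wh 1 g 0 = wh 0 g 1 \<bullet> wh 1 c 0 \<bullet> wh 0 c 1"
  using c_left[of g] br_add_right[of 1 1 1] by (simp add: tns_idn_wh cmp_assoc)

lemma c_right_2: "arr g \<Longrightarrow> dm g = 2 \<Longrightarrow> cd g = 2 \<Longrightarrow>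
  wh 0 c 1 \<bullet> wh 1 c 0 \<bullet> wh 0 g 1 = wh 1 g 0 \<bullet> wh 0 c 1 \<bullet> wh 1 c 0"
  using c_right[of g] br_add_left[of 1 1 1] by (simp add: tns_idn_wh cmp_assoc)

lemma braid_relation: "wh 0 c 1 \<bullet> wh 1 c 0 \<bullet> wh 0 c 1 = wh 1 c 0 \<bullet> wh 0 c 1 \<bullet> wh 1 c 0"
  using c_right_2[of c] by simp

text \<open>The Garside element of the braid group on three strands.\<close>

definition half_twist :: 'a where
  "half_twist = wh 0 c 1 \<bullet> wh 1 c 0 \<bullet> wh 0 c 1"

lemma half_twist [simp]: "arr half_twist" "dm half_twist = 3" "cd half_twist = 3"
  by (simp_all add: half_twist_def)

lemma half_twist_split: "half_twist \<bullet> wh 0 ci 1 \<bullet> wh 1 ci 0 \<bullet> wh 0 ci 1 = idn 3"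
  using wh_c_ci_assoc(1)[of "wh 1 ci 0 \<bullet> wh 0 ci 1" 0 1] wh_c_ci_assoc(1)[of "wh 0 ci 1" 1 0]
    wh_c_ci(1)[of 0 1]
  by (simp add: half_twist_def cmp_assoc)

text \<open>Two of the three crossings carry a strand past \<open>g\<close> by naturality; the third
  is left over and becomes the conjugation by \<open>c\<close>.\<close>

lemma half_twist_slide:
  assumes "arr g" "dm g = 2" "cd g = 2"
  shows "half_twist \<bullet> wh 0 g 1 = wh 1 (c \<bullet> g \<bullet> ci) 0 \<bullet> half_twist"
    and "half_twist \<bullet> wh 1 g 0 = wh 0 (c \<bullet> g \<bullet> ci) 1 \<bullet> half_twist"
proof -
  have "half_twist \<bullet> wh 0 g 1 = wh 1 c 0 \<bullet> wh 1 g 0 \<bullet> wh 0 c 1 \<bullet> wh 1 c 0"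
    using assms by (simp add: half_twist_def braid_relation cmp_assoc c_right_2)
  then show "half_twist \<bullet> wh 0 g 1 = wh 1 (c \<bullet> g \<bullet> ci) 0 \<bullet> half_twist"
    using assms wh_c_ci_assoc(2)[of "wh 0 c 1 \<bullet> wh 1 c 0" 1 0]
    by (simp add: half_twist_def braid_relation cmp_assoc wh_cmp)
  have "half_twist \<bullet> wh 1 g 0 = wh 0 c 1 \<bullet> wh 0 g 1 \<bullet> wh 1 c 0 \<bullet> wh 0 c 1"
    using assms by (simp add: half_twist_def cmp_assoc c_left_2)
  then show "half_twist \<bullet> wh 1 g 0 = wh 0 (c \<bullet> g \<bullet> ci) 1 \<bullet> half_twist"
    using assms wh_c_ci_assoc(2)[of "wh 1 c 0 \<bullet> wh 0 c 1" 0 1]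
    by (simp add: half_twist_def cmp_assoc wh_cmp)
qed

lemma half_twist_slide_c:
  "half_twist \<bullet> wh 0 c 1 = wh 1 c 0 \<bullet> half_twist" "half_twist \<bullet> wh 1 c 0 = wh 0 c 1 \<bullet> half_twist"
  "half_twist \<bullet> wh 0 ci 1 = wh 1 ci 0 \<bullet> half_twist" "half_twist \<bullet> wh 1 ci 0 = wh 0 ci 1 \<bullet> half_twist"
  using half_twist_slide[of c] half_twist_slide[of ci] br_bri[of 1 1] wh_c_ci_assoc(1)[of ci 0 0]
  by (simp_all add: cmp_assoc)

text \<open>Diagrams are reflected in a vertical line. The blocks being braided change places, and
  so do the two hexagons.\<close>

lemma reverse_braided_pro:
  "braided_pro arr dm cd idn (\<bullet>) (\<lambda>f g. g \<boxtimes> f) (\<lambda>m n. br n m) (\<lambda>m n. bri n m)"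
proof unfold_locales
  show "br (m + n) l = br n l \<boxtimes> idn m \<bullet> idn n \<boxtimes> br m l" for l m n
    using br_add_left[of n m l] by (simp add: add.commute)
  show "br n (l + m) = idn m \<boxtimes> br n l \<bullet> br n m \<boxtimes> idn l" for l m n
    using br_add_right[of n m l] by (simp add: add.commute)
qed (simp_all add: cmp_assoc tns_assoc tns_idn add.commute tns_cmp br_bri bri_br br_natural)

end

section \<open>Multiplier bimonoids and their antipodes on strings\<close>

locale pro_bimonoid = braided_pro +
  fixes t1 t2 e :: 'a
  assumes t1 [simp]: "arr t1" "dm t1 = 2" "cd t1 = 2"
    and t2 [simp]: "arr t2" "dm t2 = 2" "cd t2 = 2"
    and e [simp]: "arr e" "dm e = 1" "cd e = 0"
    and fusion1: "t1 \<boxtimes> idn 1 \<bullet> ci \<boxtimes> idn 1 \<bullet> idn 1 \<boxtimes> t1 \<bullet> c \<boxtimes> idn 1 \<bullet> idn 1 \<boxtimes> t1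
      = idn 1 \<boxtimes> t1 \<bullet> t1 \<boxtimes> idn 1"
    and counit1: "idn 1 \<boxtimes> e \<bullet> t1 = idn 1 \<boxtimes> e"
    and fusion2: "idn 1 \<boxtimes> t2 \<bullet> idn 1 \<boxtimes> ci \<bullet> t2 \<boxtimes> idn 1 \<bullet> idn 1 \<boxtimes> c \<bullet> t2 \<boxtimes> idn 1
      = t2 \<boxtimes> idn 1 \<bullet> idn 1 \<boxtimes> t2"
    and counit2: "e \<boxtimes> idn 1 \<bullet> t2 = e \<boxtimes> idn 1"
    and compatible: "idn 1 \<boxtimes> t1 \<bullet> t2 \<boxtimes> idn 1 = t2 \<boxtimes> idn 1 \<bullet> idn 1 \<boxtimes> t1"
    and same_mult: "e \<boxtimes> idn 1 \<bullet> t1 = idn 1 \<boxtimes> e \<bullet> t2"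
begin

lemma reverse_pro_bimonoid:
  "pro_bimonoid arr dm cd idn (\<bullet>) (\<lambda>f g. g \<boxtimes> f) (\<lambda>m n. br n m) (\<lambda>m n. bri n m) t2 t1 e"
  by (intro pro_bimonoid.intro reverse_braided_pro pro_bimonoid_axioms.intro)
    (simp_all add: fusion1 fusion2 counit1 counit2 compatible same_mult)

definition m :: 'a where "m = e \<boxtimes> idn 1 \<bullet> t1"

lemma m [simp]: "arr m" "dm m = 2" "cd m = 1"
  by (simp_all add: m_def)

lemma fusion1_wh:
  "wh i t1 (j + 1) \<bullet> wh i ci (j + 1) \<bullet> wh (i + 1) t1 j \<bullet> wh i c (j + 1) \<bullet> wh (i + 1) t1 j
    = wh (i + 1) t1 j \<bullet> wh i t1 (j + 1)"
  using arg_cong[OF fusion1, of "\<lambda>f. wh i f j"] by (simp add: tns_idn_wh wh_cmp add.commute)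

lemma counit1_wh: "wh (i + 1) e j \<bullet> wh i t1 j = wh (i + 1) e j"
  using arg_cong[OF counit1, of "\<lambda>f. wh i f j"] by (simp add: tns_idn_wh wh_cmp)

lemma m_wh: "wh i e (j + 1) \<bullet> wh i t1 j = wh i m j" "wh (i + 1) e j \<bullet> wh i t2 j = wh i m j"
  using arg_cong[OF same_mult, of "\<lambda>f. wh i f j"]
  by (simp_all add: m_def tns_idn_wh wh_cmp add.commute)

lemma discard_c:
  "wh (i + 1) e j \<bullet> wh i c j = wh i e (j + 1)" "wh i e (j + 1) \<bullet> wh i c j = wh (i + 1) e j"
  "wh (i + 1) e j \<bullet> wh i ci j = wh i e (j + 1)" "wh i e (j + 1) \<bullet> wh i ci j = wh (i + 1) e j"
  using c_discard[OF e, THEN arg_cong, of "\<lambda>f. wh i f j"]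
    ci_discard[OF e, THEN arg_cong, of "\<lambda>f. wh i f j"]
  by (simp_all add: wh_cmp add.commute)

text \<open>This is the fusion equation with its middle output discarded: the counit absorbs the
  outermost \<open>t1\<close> on the left side. For a Hopf algebra, where \<open>t1\<close> sends a
  \<otimes> b to a_1 \<otimes> a_2 b, it reads a_1 \<otimes> a_2 (b c) = a_1 \<otimes> (a_2 b)
  c.\<close>

lemma t1_mult_right: "t1 \<bullet> wh 1 m 0 = wh 1 m 0 \<bullet> wh 0 t1 1"
proof -
  have ex: "wh 0 e 2 \<bullet> wh 1 t1 0 = t1 \<bullet> wh 0 e 2"
    by (subst exchange[of e t1 1 0 0 0 2 0 2]) simp_all
  have "t1 \<bullet> wh 1 m 0 = t1 \<bullet> wh 0 e 2 \<bullet> wh 0 c 1 \<bullet> wh 1 t1 0"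
    using discard_c(2)[of 0 1, THEN cmp_cong] m_wh(1)[of 1 0] by (simp add: cmp_assoc)
  also have "\<dots> = wh 0 e 2 \<bullet> wh 1 t1 0 \<bullet> wh 0 c 1 \<bullet> wh 1 t1 0"
    by (simp add: ex[THEN cmp_cong2] cmp_assoc)
  also have "\<dots> = wh 1 e 1 \<bullet> wh 0 ci 1 \<bullet> wh 1 t1 0 \<bullet> wh 0 c 1 \<bullet> wh 1 t1 0"
    using discard_c(3)[of 0 1, THEN cmp_cong] by (simp add: cmp_assoc)
  also have "\<dots> = wh 1 e 1 \<bullet> wh 0 t1 1 \<bullet> wh 0 ci 1 \<bullet> wh 1 t1 0 \<bullet> wh 0 c 1 \<bullet> wh 1 t1 0"
    using counit1_wh[of 0 1, THEN cmp_cong] by (simp add: cmp_assoc)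
  also have "\<dots> = wh 1 e 1 \<bullet> wh 1 t1 0 \<bullet> wh 0 t1 1"
    using fusion1_wh[of 0 0] by simp
  also have "\<dots> = wh 1 m 0 \<bullet> wh 0 t1 1"
    using m_wh(1)[of 1 0, THEN cmp_cong] by (simp add: cmp_assoc)
  finally show ?thesis .
qed

text \<open>This is the fusion equation with its first output discarded. For a Hopf algebra it is
  multiplicativity of the comultiplication, \<Delta>(a b) (1 \<otimes> c) = \<Delta>(a) \<Delta>(b)
  (1 \<otimes> c).\<close>

lemma t1_mult_left:
  "t1 \<bullet> wh 0 m 1 = wh 0 m 1 \<bullet> wh 0 ci 1 \<bullet> wh 1 t1 0 \<bullet> wh 0 c 1 \<bullet> wh 1 t1 0"
proof -
  have ex: "wh 0 e 2 \<bullet> wh 1 t1 0 = t1 \<bullet> wh 0 e 2"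
    by (subst exchange[of e t1 1 0 0 0 2 0 2]) simp_all
  have "t1 \<bullet> wh 0 m 1 = t1 \<bullet> wh 0 e 2 \<bullet> wh 0 t1 1"
    using m_wh(1)[of 0 1] by simp
  also have "\<dots> = wh 0 e 2 \<bullet> wh 1 t1 0 \<bullet> wh 0 t1 1"
    by (simp add: ex[THEN cmp_cong2] cmp_assoc)
  also have "\<dots> = wh 0 e 2 \<bullet> wh 0 t1 1 \<bullet> wh 0 ci 1 \<bullet> wh 1 t1 0 \<bullet> wh 0 c 1 \<bullet> wh 1 t1 0"
    using fusion1_wh[of 0 0] by simp
  also have "\<dots> = wh 0 m 1 \<bullet> wh 0 ci 1 \<bullet> wh 1 t1 0 \<bullet> wh 0 c 1 \<bullet> wh 1 t1 0"
    using m_wh(1)[of 0 1, THEN cmp_cong] by (simp add: cmp_assoc)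
  finally show ?thesis .
qed

text \<open>Discarding the first output in \<open>t1_mult_right\<close> leaves
  associativity.\<close>

lemma mult_assoc: "m \<bullet> wh 0 m 1 = m \<bullet> wh 1 m 0"
proof -
  have ex: "wh 0 e 1 \<bullet> wh 1 m 0 = m \<bullet> wh 0 e 2"
    by (subst exchange[of e m 1 0 0 0 1 0 2]) simp_all
  have "m \<bullet> wh 1 m 0 = wh 0 e 1 \<bullet> t1 \<bullet> wh 1 m 0"
    using m_wh(1)[of 0 0, THEN cmp_cong] by (simp add: cmp_assoc)
  also have "\<dots> = m \<bullet> wh 0 e 2 \<bullet> wh 0 t1 1"
    by (simp add: ex[THEN cmp_cong2] cmp_assoc t1_mult_right)
  also have "\<dots> = m \<bullet> wh 0 m 1"
    using m_wh(1)[of 0 1] by simp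
  finally show ?thesis by simp
qed

lemma counit_exchange: "e \<bullet> wh 1 e 0 = e \<bullet> wh 0 e 1"
  using tns_wh[of e e] tns_wh'[of e e] by simp

text \<open>When both outputs of \<open>t1\<close> are discarded, the second may go first, and then
  the counit axiom absorbs \<open>t1\<close>.\<close>

lemma counit_mult: "e \<bullet> m = e \<bullet> wh 0 e 1"
proof -
  have "e \<bullet> m = e \<bullet> wh 0 e 1 \<bullet> t1"
    using m_wh(1)[of 0 0] by simp
  also have "\<dots> = e \<bullet> wh 1 e 0 \<bullet> t1"
    by (simp add: counit_exchange[THEN cmp_cong2] cmp_assoc)
  also have "\<dots> = e \<bullet> wh 0 e 1"
    using counit_exchange counit1_wh[of 0 0] by simp
  finally show ?thesis .
qed

section \<open>The opposite multiplier bimonoid\<close>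

text \<open>Conjugation by the half twist interchanges the two fusion equations.\<close>

lemma opposite_fusion1:
  defines "t \<equiv> c \<bullet> t2 \<bullet> ci"
  shows "t \<boxtimes> idn 1 \<bullet> ci \<boxtimes> idn 1 \<bullet> idn 1 \<boxtimes> t \<bullet> c \<boxtimes> idn 1 \<bullet> idn 1 \<boxtimes> t
      = idn 1 \<boxtimes> t \<bullet> t \<boxtimes> idn 1"
proof (rule cancel_split_epi[OF _ half_twist_split])
  have t [simp]: "arr t" "dm t = 2" "cd t = 2"
    by (simp_all add: t_def)
  have "half_twist \<bullet> wh 1 t2 0 \<bullet> wh 1 ci 0 \<bullet> wh 0 t2 1 \<bullet> wh 1 c 0 \<bullet> wh 0 t2 1
      = wh 0 t 1 \<bullet> wh 0 ci 1 \<bullet> wh 1 t 0 \<bullet> wh 0 c 1 \<bullet> wh 1 t 0 \<bullet> half_twist"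
    by (simp add: half_twist_slide half_twist_slide[THEN cmp_cong, unfolded cmp_assoc]
        half_twist_slide_c half_twist_slide_c[THEN cmp_cong, unfolded cmp_assoc] flip: t_def)
  moreover have "half_twist \<bullet> wh 0 t2 1 \<bullet> wh 1 t2 0 = wh 1 t 0 \<bullet> wh 0 t 1 \<bullet> half_twist"
    by (simp add: half_twist_slide half_twist_slide[THEN cmp_cong, unfolded cmp_assoc]
        flip: t_def)
  ultimately show "(t \<boxtimes> idn 1 \<bullet> ci \<boxtimes> idn 1 \<bullet> idn 1 \<boxtimes> t \<bullet> c \<boxtimes> idn 1 \<bullet> idn 1 \<boxtimes> t) \<bullet> half_twist
      = (idn 1 \<boxtimes> t \<bullet> t \<boxtimes> idn 1) \<bullet> half_twist"
    using fusion2 by (simp add: tns_idn_wh cmp_assoc)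
qed (simp_all add: t_def)

lemma opposite_compatible:
  defines "t \<equiv> c \<bullet> t2 \<bullet> ci" and "t' \<equiv> c \<bullet> t1 \<bullet> ci"
  shows "idn 1 \<boxtimes> t \<bullet> t' \<boxtimes> idn 1 = t' \<boxtimes> idn 1 \<bullet> idn 1 \<boxtimes> t"
proof (rule cancel_split_epi[OF _ half_twist_split])
  have t [simp]: "arr t" "dm t = 2" "cd t = 2" "arr t'" "dm t' = 2" "cd t' = 2"
    by (simp_all add: t_def t'_def)
  have "half_twist \<bullet> wh 1 t1 0 \<bullet> wh 0 t2 1 = wh 0 t' 1 \<bullet> wh 1 t 0 \<bullet> half_twist"
    by (simp add: half_twist_slide half_twist_slide[THEN cmp_cong, unfolded cmp_assoc]
        flip: t_def t'_def)
  moreover have "half_twist \<bullet> wh 0 t2 1 \<bullet> wh 1 t1 0 = wh 1 t 0 \<bullet> wh 0 t' 1 \<bullet> half_twist"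
    by (simp add: half_twist_slide half_twist_slide[THEN cmp_cong, unfolded cmp_assoc]
        flip: t_def t'_def)
  ultimately show "(idn 1 \<boxtimes> t \<bullet> t' \<boxtimes> idn 1) \<bullet> half_twist
      = (t' \<boxtimes> idn 1 \<bullet> idn 1 \<boxtimes> t) \<bullet> half_twist"
    using compatible by (simp add: tns_idn_wh cmp_assoc)
qed (simp_all add: t_def t'_def)

lemma opposite_counit: "idn 1 \<boxtimes> e \<bullet> c \<bullet> t2 \<bullet> ci = idn 1 \<boxtimes> e"
proof -
  have "wh 1 e 0 \<bullet> c \<bullet> t2 \<bullet> ci = wh 0 e 1 \<bullet> t2 \<bullet> ci"
    using discard_c(1)[of 0 0, THEN cmp_cong, of "t2 \<bullet> ci"] by (simp add: cmp_assoc)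
  also have "\<dots> = wh 0 e 1 \<bullet> ci"
    using counit2[THEN cmp_cong, of ci] by (simp add: tns_idn_wh cmp_assoc)
  finally show ?thesis
    using discard_c(4)[of 0 0] by (simp add: tns_idn_wh)
qed

lemma opposite_mult: "e \<boxtimes> idn 1 \<bullet> c \<bullet> t2 \<bullet> ci = m \<bullet> ci"
  using discard_c(2)[of 0 0, THEN cmp_cong, of "t2 \<bullet> ci"] m_wh(2)[of 0 0, THEN cmp_cong, of ci]
  by (simp add: tns_idn_wh cmp_assoc)

lemma opposite_pro_bimonoid:
  "pro_bimonoid arr dm cd idn (\<bullet>) (\<boxtimes>) br bri (c \<bullet> t2 \<bullet> ci) (c \<bullet> t1 \<bullet> ci) e"
proof
  \<comment> \<open>The fusion and counit axioms for the second structure map of the opposite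
    bimonoid are mirror images of those for the first. Both mirror images have the same
    multiplication, which yields the last axiom.\<close>
  interpret reverse: pro_bimonoid arr dm cd idn cmp "\<lambda>f g. g \<boxtimes> f" "\<lambda>m n. br n m" "\<lambda>m n. bri n m" t2 t1 e
    by (rule reverse_pro_bimonoid)
  have "reverse.m = m"
    by (simp add: reverse.m_def m_def same_mult)
  then show "e \<boxtimes> idn 1 \<bullet> c \<bullet> t2 \<bullet> ci = idn 1 \<boxtimes> e \<bullet> c \<bullet> t1 \<bullet> ci"
    by (simp add: opposite_mult reverse.opposite_mult)
qed (simp_all add: opposite_fusion1 opposite_counit opposite_compatible
    pro_bimonoid.opposite_fusion1[OF reverse_pro_bimonoid]
    pro_bimonoid.opposite_counit[OF reverse_pro_bimonoid])

end

section \<open>The axioms of a morphism for the antipode, on strings\<close>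

locale pro_hopf_monoid = pro_bimonoid +
  fixes u1 u2 :: 'a
  assumes u1 [simp]: "arr u1" "dm u1 = 2" "cd u1 = 2"
    and u2 [simp]: "arr u2" "dm u2 = 2" "cd u2 = 2"
    and t1_u1: "t1 \<bullet> u1 = idn 2"
    and u1_t1: "u1 \<bullet> t1 = idn 2"
    and t2_u2: "t2 \<bullet> u2 = idn 2"
    and u2_t2: "u2 \<bullet> t2 = idn 2"
begin

lemma reverse_pro_hopf_monoid:
  "pro_hopf_monoid arr dm cd idn (\<bullet>) (\<lambda>f g. g \<boxtimes> f) (\<lambda>m n. br n m) (\<lambda>m n. bri n m)
    t2 t1 e u2 u1"
  by (intro pro_hopf_monoid.intro reverse_pro_bimonoid pro_hopf_monoid_axioms.intro)
    (simp_all add: t1_u1 u1_t1 t2_u2 u2_t2)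

text \<open>For a Hopf algebra with antipode S, \<open>s1\<close> sends a \<otimes> b to S(a) b, and
  \<open>s2\<close> sends a \<otimes> b to a S(b).\<close>

definition s1 :: 'a where "s1 = e \<boxtimes> idn 1 \<bullet> u1"
definition s2 :: 'a where "s2 = idn 1 \<boxtimes> e \<bullet> u2"

lemma s1 [simp]: "arr s1" "dm s1 = 2" "cd s1 = 1"
  by (simp_all add: s1_def)

lemma s2 [simp]: "arr s2" "dm s2 = 2" "cd s2 = 1"
  by (simp_all add: s2_def)

lemma wh_t1_u1: "wh i t1 j \<bullet> wh i u1 j = idn (i + 2 + j)"
  by (simp add: t1_u1 flip: wh_cmp)

lemma wh_t1_u1_assoc: "arr h \<Longrightarrow> cd h = i + 2 + j \<Longrightarrow> wh i t1 j \<bullet> wh i u1 j \<bullet> h = h"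
  by (simp add: wh_t1_u1 flip: cmp_assoc)

lemma wh_t2_u2: "wh i t2 j \<bullet> wh i u2 j = idn (i + 2 + j)"
  by (simp add: t2_u2 flip: wh_cmp)

lemma s1_t1: "wh i s1 j \<bullet> wh i t1 j = wh i e (j + 1)"
  by (simp add: s1_def tns_idn_wh cmp_assoc u1_t1 add.commute flip: wh_cmp)

lemma s2_t2: "wh i s2 j \<bullet> wh i t2 j = wh (i + 1) e j"
  by (simp add: s2_def tns_idn_wh cmp_assoc u2_t2 flip: wh_cmp)

lemma counit_s1: "e \<bullet> s1 = e \<boxtimes> e"
proof (rule cancel_split_epi[OF _ t1_u1])
  show "(e \<bullet> s1) \<bullet> t1 = (e \<boxtimes> e) \<bullet> t1"
    using s1_t1[of 0 0] counit1_wh[of 0 0]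
    by (simp add: tns_wh cmp_assoc counit_exchange[symmetric]
        counit_exchange[symmetric, THEN cmp_cong2])
qed simp_all

text \<open>Associativity in disguise. The factors of \<open>?p\<close> commute by the compatibility
  axiom, so either one can be placed next to the antipode component that it eliminates; the other
  one then contributes a multiplication, and both sides become triple products.\<close>

lemma antipode_M_morphism: "m \<bullet> idn 1 \<boxtimes> s1 = m \<bullet> s2 \<boxtimes> idn 1"
proof (rule cancel_split_epi)
  let ?p = "wh 0 t2 1 \<bullet> wh 1 t1 0" and ?q = "wh 1 u1 0 \<bullet> wh 0 u2 1"
  have comm: "?p = wh 1 t1 0 \<bullet> wh 0 t2 1"
    using compatible by (simp add: tns_idn_wh)
  have "m \<bullet> wh 1 s1 0 \<bullet> ?p = m \<bullet> wh 1 e 1 \<bullet> wh 0 t2 1"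
    unfolding comm using s1_t1[of 1 0, THEN cmp_cong] by (simp add: cmp_assoc)
  also have "\<dots> = m \<bullet> wh 1 m 0"
    using m_wh(2)[of 0 1] mult_assoc by simp
  also have "\<dots> = m \<bullet> wh 1 e 1 \<bullet> wh 1 t1 0"
    using m_wh(1)[of 1 0] by simp
  also have "\<dots> = m \<bullet> wh 0 s2 1 \<bullet> ?p"
    using s2_t2[of 0 1, THEN cmp_cong] by (simp add: cmp_assoc)
  finally show "(m \<bullet> idn 1 \<boxtimes> s1) \<bullet> ?p = (m \<bullet> s2 \<boxtimes> idn 1) \<bullet> ?p"
    by (simp add: tns_idn_wh cmp_assoc)
  show "?p \<bullet> ?q = idn 3"
    using wh_t1_u1_assoc[of "wh 0 u2 1" 1 0] wh_t2_u2[of 0 1]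
    by (simp add: cmp_assoc)
qed simp_all

text \<open>For a Hopf algebra: S(a) S(b) c = S(b a) c. The arrow \<open>?p\<close> is chosen as the
  tail of the right side of \<open>t1_mult_left\<close>, so that on the right the product is formed
  first and then meets \<open>t1\<close>. Both sides end up discarding the first two
  strands.\<close>

lemma antipode_antimultiplicative: "s1 \<bullet> idn 1 \<boxtimes> s1 = s1 \<bullet> (m \<bullet> ci) \<boxtimes> idn 1"
proof (rule cancel_split_epi)
  let ?p = "wh 1 t1 0 \<bullet> wh 0 c 1 \<bullet> wh 1 t1 0" and ?q = "wh 1 u1 0 \<bullet> wh 0 ci 1 \<bullet> wh 1 u1 0"
  have ex: "wh 0 e 2 \<bullet> wh 1 t1 0 = t1 \<bullet> wh 0 e 2"
    by (subst exchange[of e t1 1 0 0 0 2 0 2]) simp_all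
  have "s1 \<bullet> wh 1 s1 0 \<bullet> ?p = s1 \<bullet> wh 1 e 1 \<bullet> wh 0 c 1 \<bullet> wh 1 t1 0"
    using s1_t1[of 1 0, THEN cmp_cong] by (simp add: cmp_assoc)
  also have "\<dots> = s1 \<bullet> wh 0 e 2 \<bullet> wh 1 t1 0"
    using discard_c(1)[of 0 1, THEN cmp_cong] by (simp add: cmp_assoc)
  also have "\<dots> = wh 0 e 1 \<bullet> wh 0 e 2"
    using s1_t1[of 0 0, THEN cmp_cong] by (simp add: ex cmp_assoc)
  also have "\<dots> = wh 0 e 1 \<bullet> wh 0 m 1"
    using counit_mult[THEN arg_cong, of "\<lambda>f. wh 0 f 1"] by (simp add: wh_cmp)
  also have "\<dots> = s1 \<bullet> t1 \<bullet> wh 0 m 1"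
    using s1_t1[of 0 0, THEN cmp_cong] by (simp add: cmp_assoc)
  also have "\<dots> = s1 \<bullet> wh 0 m 1 \<bullet> wh 0 ci 1 \<bullet> ?p"
    by (simp add: t1_mult_left)
  finally show "(s1 \<bullet> idn 1 \<boxtimes> s1) \<bullet> ?p = (s1 \<bullet> (m \<bullet> ci) \<boxtimes> idn 1) \<bullet> ?p"
    by (simp add: tns_idn_wh cmp_assoc wh_cmp)
  show "?p \<bullet> ?q = idn 3"
    using wh_t1_u1_assoc[of "wh 0 ci 1 \<bullet> wh 1 u1 0" 1 0] wh_t1_u1[of 1 0]
      wh_c_ci_assoc(1)[of "wh 1 u1 0" 0 1]
    by (simp add: cmp_assoc)
qed simp_all

text \<open>For a Hopf algebra: $b_1 \otimes S(b_2 a) b_3 c = b \otimes S(a) c$.\<close>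

lemma s1_t1_t1:
  "wh 1 s1 j \<bullet> wh 0 t1 (j + 1) \<bullet> wh 0 ci (j + 1) \<bullet> wh 1 t1 j = wh 1 s1 j \<bullet> wh 0 ci (j + 1)"
proof (rule cancel_split_epi)
  \<comment> \<open>Precomposing with \<open>?p\<close> completes the left side to one side of the
    fusion equation. On its other side \<open>t1\<close> stands directly below the antipode, and
    both sides reduce to discarding the middle strand.\<close>
  let ?p = "wh 0 c (j + 1) \<bullet> wh 1 t1 j" and ?q = "wh 1 u1 j \<bullet> wh 0 ci (j + 1)"
  have "(wh 1 s1 j \<bullet> wh 0 t1 (j + 1) \<bullet> wh 0 ci (j + 1) \<bullet> wh 1 t1 j) \<bullet> ?p
      = wh 1 s1 j \<bullet> wh 1 t1 j \<bullet> wh 0 t1 (j + 1)"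
    using fusion1_wh[of 0 j] by (simp add: cmp_assoc)
  also have "\<dots> = wh 1 e (j + 1)"
    using s1_t1[of 1 j, THEN cmp_cong] counit1_wh[of 0 "j + 1"] by (simp add: cmp_assoc)
  also have "\<dots> = (wh 1 s1 j \<bullet> wh 0 ci (j + 1)) \<bullet> ?p"
    using s1_t1[of 1 j] wh_c_ci_assoc(2)[of "wh 1 t1 j" 0 "j + 1"] by (simp add: cmp_assoc)
  finally show "(wh 1 s1 j \<bullet> wh 0 t1 (j + 1) \<bullet> wh 0 ci (j + 1) \<bullet> wh 1 t1 j) \<bullet> ?p
      = (wh 1 s1 j \<bullet> wh 0 ci (j + 1)) \<bullet> ?p" .
  show "?p \<bullet> ?q = idn (0 + 2 + (j + 1))"
    using wh_t1_u1_assoc[of "wh 0 ci (j + 1)" 1 j] wh_c_ci(1)[of 0 "j + 1"]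
    by (simp add: cmp_assoc)
qed simp_all

lemma antipode_comultiplicative:
  "s1 \<boxtimes> idn 1 \<bullet> idn 1 \<boxtimes> t1 \<bullet> idn 1 \<boxtimes> (s1 \<boxtimes> idn 1)
    = s1 \<boxtimes> s1 \<bullet> idn 1 \<boxtimes> (c \<boxtimes> idn 1) \<bullet> (c \<bullet> t1 \<bullet> ci) \<boxtimes> t1"
proof (rule cancel_split_epi)
  note slide = c_left[OF s1(1,2), unfolded s1(3)]
  \<comment> \<open>As the antipode merges two strands, the two crossings of these strands with a
    third one become a single crossing after it. In \<open>slide2\<close> the crossings are
    inverted.\<close>
  have slide1: "wh 0 s1 2 \<bullet> wh 1 c 1 \<bullet> wh 0 c 2 = wh 0 c 1 \<bullet> wh 1 s1 1"
    using slide[THEN arg_cong, of "\<lambda>f. wh 0 f 1"] by (simp add: wh_cmp)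
  have slide2: "wh 1 s1 1 \<bullet> wh 0 ci 2 \<bullet> wh 1 ci 1 = wh 0 ci 1 \<bullet> wh 0 s1 2"
  proof -
    have "wh 1 s1 1 \<bullet> wh 0 ci 2 \<bullet> wh 1 ci 1
        = wh 0 ci 1 \<bullet> (wh 0 c 1 \<bullet> wh 1 s1 1) \<bullet> wh 0 ci 2 \<bullet> wh 1 ci 1"
      using wh_c_ci_assoc(2)[of "wh 1 s1 1 \<bullet> wh 0 ci 2 \<bullet> wh 1 ci 1" 0 1] by (simp add: cmp_assoc)
    also have "\<dots> = wh 0 ci 1 \<bullet> wh 0 s1 2"
      using wh_c_ci_assoc(1)[of "wh 1 ci 1" 0 2] wh_c_ci(1)[of 1 1]
      by (simp add: cmp_assoc flip: slide1)
    finally show ?thesis .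
  qed
  have ex1: "wh 0 s1 2 \<bullet> wh 2 t1 0 = wh 1 t1 0 \<bullet> wh 0 s1 2"
    by (subst exchange[of s1 t1 2 0 0 1 2 0 2]) simp_all
  have ex2: "wh 0 s1 1 \<bullet> wh 2 e 1 = wh 1 e 1 \<bullet> wh 0 s1 2"
    by (subst exchange[of s1 e 2 0 0 1 1 1 2]) simp_all
  have ex3: "wh 1 e 2 \<bullet> wh 2 t1 0 = wh 1 t1 0 \<bullet> wh 1 e 2"
    by (subst exchange[of e t1 2 1 0 1 2 0 2]) simp_all
  \<comment> \<open>By the fusion equation \<open>wh 2 t1 0\<close> followed after
    \<open>wh 1 t1 1\<close> in the composite equals \<open>wh 1 t1 1\<close>, an inverse crossing,
    and then \<open>?r\<close>. The first two are what \<open>s1_t1_t1\<close> needs;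
    \<open>?r\<close> waits at the right end.\<close>
  let ?r = "wh 2 t1 0 \<bullet> wh 1 c 1 \<bullet> wh 2 t1 0"
  have "wh 1 s1 0 \<bullet> wh 0 s1 2 \<bullet> wh 1 c 1 \<bullet> wh 0 c 2 \<bullet> wh 0 t1 2 \<bullet> wh 0 ci 2 \<bullet> wh 2 t1 0 \<bullet> wh 1 t1 1
      = wh 1 s1 0 \<bullet> (wh 0 s1 2 \<bullet> wh 1 c 1 \<bullet> wh 0 c 2) \<bullet> wh 0 t1 2 \<bullet> wh 0 ci 2
          \<bullet> wh 1 t1 1 \<bullet> wh 1 ci 1 \<bullet> ?r"
    using fusion1_wh[of 1 0] by (simp add: cmp_assoc)
  also have "\<dots> = wh 1 s1 0 \<bullet> wh 0 c 1 \<bullet>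
      (wh 1 s1 1 \<bullet> wh 0 t1 2 \<bullet> wh 0 ci 2 \<bullet> wh 1 t1 1) \<bullet> wh 1 ci 1 \<bullet> ?r"
    by (simp only: slide1 cmp_assoc)
  also have "\<dots> = wh 1 s1 0 \<bullet> wh 0 c 1 \<bullet> (wh 1 s1 1 \<bullet> wh 0 ci 2 \<bullet> wh 1 ci 1) \<bullet> ?r"
    using s1_t1_t1[of 1] by (simp add: cmp_assoc)
  also have "\<dots> = wh 1 s1 0 \<bullet> (wh 0 s1 2 \<bullet> wh 2 t1 0) \<bullet> wh 1 c 1 \<bullet> wh 2 t1 0"
    using wh_c_ci_assoc(1)[of "wh 0 s1 2 \<bullet> ?r" 0 1] by (simp add: slide2 cmp_assoc)
  \<comment> \<open>The first antipode merges two strands to the left of \<open>t1\<close>, so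
    \<open>t1\<close> slides past it one position further left and meets the second antipode
    there.\<close>
  also have "\<dots> = (wh 1 e 1 \<bullet> wh 0 s1 2) \<bullet> wh 1 c 1 \<bullet> wh 2 t1 0"
    using s1_t1[of 1 0, THEN cmp_cong] by (simp add: ex1 cmp_assoc)
  also have "\<dots> = wh 0 s1 1 \<bullet> wh 1 e 2 \<bullet> wh 2 t1 0"
    using discard_c(1)[of 1 1, THEN cmp_cong] by (simp add: cmp_assoc flip: ex2)
  also have "\<dots> = wh 0 s1 1 \<bullet> wh 1 t1 0 \<bullet> wh 1 s1 1 \<bullet> wh 1 t1 1"
    using s1_t1[of 1 1] by (simp add: ex3)
  finally show "(s1 \<boxtimes> idn 1 \<bullet> idn 1 \<boxtimes> t1 \<bullet> idn 1 \<boxtimes> (s1 \<boxtimes> idn 1)) \<bullet> wh 1 t1 1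
    = (s1 \<boxtimes> s1 \<bullet> idn 1 \<boxtimes> (c \<boxtimes> idn 1) \<bullet> (c \<bullet> t1 \<bullet> ci) \<boxtimes> t1) \<bullet> wh 1 t1 1"
    by (simp add: tns_idn_wh tns_wh'[of s1 s1] tns_wh[of "c \<bullet> t1 \<bullet> ci" t1] cmp_assoc wh_cmp)
  show "wh 1 t1 1 \<bullet> wh 1 u1 1 = idn 4"
    using wh_t1_u1[of 1 1] by simp
qed simp_all

end

section \<open>Coherence\<close>

context category
begin

lemma homI: "f \<in> Arr C \<Longrightarrow> f \<in> hom C (Dom C f) (Cod C f)"
  by (simp add: hom_def)

lemma homD:
  assumes "f \<in> hom C X Y"
  shows "f \<in> Arr C" "Dom C f = X" "Cod C f = Y" "X \<in> Obj C" "Y \<in> Obj C"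
  using assms dom_obj cod_obj by (auto simp: hom_def)

lemma dom_cod_obj [simp]: "f \<in> Arr C \<Longrightarrow> Dom C f \<in> Obj C" "f \<in> Arr C \<Longrightarrow> Cod C f \<in> Obj C"
  by (simp_all add: dom_obj cod_obj)

lemma arr_ident [simp]:
  assumes "X \<in> Obj C"
  shows "\<one> X \<in> Arr C" "Dom C (\<one> X) = X" "Cod C (\<one> X) = X"
  using homD[OF ident_hom[OF assms]] by simp_all

lemma arr_comp [simp]:
  assumes "f \<in> Arr C" "g \<in> Arr C" "Dom C g = Cod C f"
  shows "g \<cdot> f \<in> Arr C" "Dom C (g \<cdot> f) = Dom C f" "Cod C (g \<cdot> f) = Cod C g"
  using homD[OF comp_hom[of f _ _ g "Cod C g"]] assms by (auto simp: hom_def)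

lemma comp_ident [simp]:
  "f \<in> Arr C \<Longrightarrow> Dom C f = X \<Longrightarrow> f \<cdot> \<one> X = f"
  "f \<in> Arr C \<Longrightarrow> Cod C f = X \<Longrightarrow> \<one> X \<cdot> f = f"
  by (auto intro: comp_ident_left comp_ident_right simp: hom_def)

lemma comp_assoc' [simp]:
  "f \<in> Arr C \<Longrightarrow> g \<in> Arr C \<Longrightarrow> h \<in> Arr C \<Longrightarrow> Dom C g = Cod C f \<Longrightarrow> Dom C h = Cod C g \<Longrightarrow>
    (h \<cdot> g) \<cdot> f = h \<cdot> g \<cdot> f"
  by (rule comp_assoc) (simp_all add: hom_def)

lemma inverse_arr_eqI:
  assumes "inverse_arrows C f g"
  shows "inverse_arr C f = g"
  unfolding inverse_arr_def
proof (rule the_equality)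
  fix h assume "inverse_arrows C f h"
  with assms have fgh: "f \<in> Arr C" "g \<in> Arr C" "h \<in> Arr C" "Dom C g = Cod C f" "Dom C h = Cod C f"
    "Cod C g = Dom C f" "Cod C h = Dom C f"
    "h \<cdot> f = \<one> (Dom C f)" "f \<cdot> g = \<one> (Cod C f)"
    by (auto simp: inverse_arrows_def hom_def)
  then have "h = h \<cdot> f \<cdot> g"
    by simp
  also have "\<dots> = (h \<cdot> f) \<cdot> g"
    using fgh(1-7) by simp
  also have "\<dots> = g"
    using fgh by (simp del: comp_assoc')
  finally show "h = g" .
qed fact

lemma inverse_arrows_inverse_arr: "iso C f \<Longrightarrow> inverse_arrows C f (inverse_arr C f)"
  unfolding iso_def using inverse_arr_eqI by metis

lemma inverse_arr [simp]:
  assumes "iso C f"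
  shows "inverse_arr C f \<in> Arr C" "Dom C (inverse_arr C f) = Cod C f"
    "Cod C (inverse_arr C f) = Dom C f"
    "inverse_arr C f \<cdot> f = \<one> (Dom C f)" "f \<cdot> inverse_arr C f = \<one> (Cod C f)"
  using inverse_arrows_inverse_arr[OF assms] by (simp_all add: inverse_arrows_def hom_def)

lemma iso_arr: "iso C f \<Longrightarrow> f \<in> Arr C"
  by (auto simp: iso_def inverse_arrows_def)

lemma inverse_arr_cancel [simp]:
  "iso C f \<Longrightarrow> h \<in> Arr C \<Longrightarrow> Cod C h = Dom C f \<Longrightarrow> inverse_arr C f \<cdot> f \<cdot> h = h"
  "iso C f \<Longrightarrow> h \<in> Arr C \<Longrightarrow> Cod C h = Cod C f \<Longrightarrow> f \<cdot> inverse_arr C f \<cdot> h = h"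
  by (simp_all add: iso_arr flip: comp_assoc')

lemma iso_inverse_arr [simp]:
  assumes "iso C f"
  shows "iso C (inverse_arr C f)" "inverse_arr C (inverse_arr C f) = f"
proof -
  have "inverse_arrows C (inverse_arr C f) f"
    using assms iso_arr[OF assms] by (simp add: inverse_arrows_def hom_def)
  then show "iso C (inverse_arr C f)" "inverse_arr C (inverse_arr C f) = f"
    using inverse_arr_eqI by (auto simp: iso_def)
qed

lemma iso_ident [simp]: "X \<in> Obj C \<Longrightarrow> iso C (\<one> X)"
  unfolding iso_def inverse_arrows_def by (rule exI[of _ "\<one> X"]) (simp add: hom_def)

lemma inverse_arr_ident [simp]: "X \<in> Obj C \<Longrightarrow> inverse_arr C (\<one> X) = \<one> X"
  by (rule inverse_arr_eqI) (simp add: inverse_arrows_def hom_def)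

lemma iso_comp [simp]:
  assumes "iso C f" "iso C g" "Dom C g = Cod C f"
  shows "iso C (g \<cdot> f)" "inverse_arr C (g \<cdot> f) = inverse_arr C f \<cdot> inverse_arr C g"
proof -
  have "inverse_arrows C (g \<cdot> f) (inverse_arr C f \<cdot> inverse_arr C g)"
    using assms by (simp add: inverse_arrows_def hom_def iso_arr)
  then show "iso C (g \<cdot> f)" "inverse_arr C (g \<cdot> f) = inverse_arr C f \<cdot> inverse_arr C g"
    using inverse_arr_eqI by (auto simp: iso_def)
qed

lemma comp_eq_assoc:
  assumes "g \<cdot> f = g' \<cdot> f'" "f \<in> Arr C" "g \<in> Arr C" "Dom C g = Cod C f" "f' \<in> Arr C" "g' \<in> Arr C"
    "Dom C g' = Cod C f'" "h \<in> Arr C" "Dom C f = Cod C h" "Dom C f' = Cod C h"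
  shows "g \<cdot> f \<cdot> h = g' \<cdot> f' \<cdot> h"
  using assms by (simp flip: comp_assoc')

lemma iso_cancel_right:
  assumes "f \<cdot> p = g \<cdot> p" "iso C p" "f \<in> Arr C" "g \<in> Arr C" "Dom C f = Cod C p" "Dom C g = Cod C p"
  shows "f = g"
proof -
  have "(f \<cdot> p) \<cdot> inverse_arr C p = (g \<cdot> p) \<cdot> inverse_arr C p"
    using assms(1) by simp
  with assms(2-) show ?thesis
    by (simp add: iso_arr)
qed

lemma iso_cancel_left:
  assumes "p \<cdot> f = p \<cdot> g" "iso C p" "f \<in> Arr C" "g \<in> Arr C" "Dom C p = Cod C f" "Dom C p = Cod C g"
  shows "f = g"
proof -
  have "inverse_arr C p \<cdot> p \<cdot> f = inverse_arr C p \<cdot> p \<cdot> g"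
    using assms(1) by simp
  with assms(2-) show ?thesis
    by (simp add: iso_arr)
qed

end

context monoidal_category
begin

declare tensor_obj [simp] unit_obj [simp] tensor_ident [simp]

lemma arr_tensor [simp]:
  assumes "f \<in> Arr C" "g \<in> Arr C"
  shows "f \<otimes> g \<in> Arr C" "Dom C (f \<otimes> g) = Dom C f \<odot> Dom C g" "Cod C (f \<otimes> g) = Cod C f \<odot> Cod C g"
  using homD[OF tensor_hom[OF homI homI, OF assms]] by simp_all

lemma tensor_comp':
  "f \<in> Arr C \<Longrightarrow> f' \<in> Arr C \<Longrightarrow> g \<in> Arr C \<Longrightarrow> g' \<in> Arr C \<Longrightarrow> Dom C f' = Cod C f \<Longrightarrow> Dom C g' = Cod C g \<Longrightarrow>
    f' \<otimes> g' \<cdot> f \<otimes> g = (f' \<cdot> f) \<otimes> (g' \<cdot> g)"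
  by (rule tensor_comp[symmetric]) (simp_all add: hom_def)

lemma tensor_comp'_assoc:
  "f \<in> Arr C \<Longrightarrow> f' \<in> Arr C \<Longrightarrow> g \<in> Arr C \<Longrightarrow> g' \<in> Arr C \<Longrightarrow> Dom C f' = Cod C f \<Longrightarrow> Dom C g' = Cod C g \<Longrightarrow>
    h \<in> Arr C \<Longrightarrow> Cod C h = Dom C f \<odot> Dom C g \<Longrightarrow>
    f' \<otimes> g' \<cdot> f \<otimes> g \<cdot> h = (f' \<cdot> f) \<otimes> (g' \<cdot> g) \<cdot> h"
  by (simp add: tensor_comp' flip: comp_assoc')

lemma iso_tensor [simp]:
  assumes "iso C f" "iso C g"
  shows "iso C (f \<otimes> g)" "inverse_arr C (f \<otimes> g) = inverse_arr C f \<otimes> inverse_arr C g"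
proof -
  have "inverse_arrows C (f \<otimes> g) (inverse_arr C f \<otimes> inverse_arr C g)"
    using assms by (simp add: inverse_arrows_def hom_def iso_arr tensor_comp')
  then show "iso C (f \<otimes> g)" "inverse_arr C (f \<otimes> g) = inverse_arr C f \<otimes> inverse_arr C g"
    using inverse_arr_eqI by (auto simp: iso_def)
qed

lemma arr_assoc [simp]:
  assumes "X \<in> Obj C" "Y \<in> Obj C" "Z \<in> Obj C"
  shows "iso C (\<a> X Y Z)"
    "\<a> X Y Z \<in> Arr C" "Dom C (\<a> X Y Z) = (X \<odot> Y) \<odot> Z" "Cod C (\<a> X Y Z) = X \<odot> (Y \<odot> Z)"
  using homD[OF assoc_hom[OF assms]] assoc_iso[OF assms] by simp_all

lemma arr_inv_assoc [simp]:
  assumes "X \<in> Obj C" "Y \<in> Obj C" "Z \<in> Obj C"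
  shows "iso C (\<a>\<^sup>- X Y Z)"
    "\<a>\<^sup>- X Y Z \<in> Arr C" "Dom C (\<a>\<^sup>- X Y Z) = X \<odot> (Y \<odot> Z)" "Cod C (\<a>\<^sup>- X Y Z) = (X \<odot> Y) \<odot> Z"
    "\<a> X Y Z \<cdot> \<a>\<^sup>- X Y Z = \<one> (X \<odot> (Y \<odot> Z))" "\<a>\<^sup>- X Y Z \<cdot> \<a> X Y Z = \<one> ((X \<odot> Y) \<odot> Z)"
  using assms by (simp_all add: inv_assoc_def)

lemma inv_assoc_cancel [simp]:
  assumes "X \<in> Obj C" "Y \<in> Obj C" "Z \<in> Obj C" "h \<in> Arr C"
  shows "Cod C h = X \<odot> (Y \<odot> Z) \<Longrightarrow> \<a> X Y Z \<cdot> \<a>\<^sup>- X Y Z \<cdot> h = h"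
    "Cod C h = (X \<odot> Y) \<odot> Z \<Longrightarrow> \<a>\<^sup>- X Y Z \<cdot> \<a> X Y Z \<cdot> h = h"
  using assms by (simp_all add: inv_assoc_def)

lemma arr_lunit [simp]:
  assumes "X \<in> Obj C"
  shows "iso C (\<l> X)" "\<l> X \<in> Arr C" "Dom C (\<l> X) = \<I> \<odot> X" "Cod C (\<l> X) = X"
  using homD[OF lunit_hom[OF assms]] lunit_iso[OF assms] by simp_all

lemma arr_runit [simp]:
  assumes "X \<in> Obj C"
  shows "iso C (\<r> X)" "\<r> X \<in> Arr C" "Dom C (\<r> X) = X \<odot> \<I>" "Cod C (\<r> X) = X"
  using homD[OF runit_hom[OF assms]] runit_iso[OF assms] by simp_all

lemma assoc_natural':
  "f \<in> Arr C \<Longrightarrow> g \<in> Arr C \<Longrightarrow> h \<in> Arr C \<Longrightarrow>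
    \<a> (Cod C f) (Cod C g) (Cod C h) \<cdot> (f \<otimes> g) \<otimes> h
      = f \<otimes> (g \<otimes> h) \<cdot> \<a> (Dom C f) (Dom C g) (Dom C h)"
  by (intro assoc_natural homI)

lemma lunit_faithful:
  assumes "\<one> \<I> \<otimes> f = \<one> \<I> \<otimes> g" "f \<in> hom C X Y" "g \<in> hom C X Y"
  shows "f = g"
proof (rule iso_cancel_right)
  show "f \<cdot> \<l> X = g \<cdot> \<l> X"
    using assms lunit_natural by metis
qed (use homD[OF assms(2)] homD[OF assms(3)] in simp_all)

lemma runit_faithful:
  assumes "f \<otimes> \<one> \<I> = g \<otimes> \<one> \<I>" "f \<in> hom C X Y" "g \<in> hom C X Y"
  shows "f = g"
proof (rule iso_cancel_right)
  show "f \<cdot> \<r> X = g \<cdot> \<r> X"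
    using assms runit_natural by metis
qed (use homD[OF assms(2)] homD[OF assms(3)] in simp_all)

text \<open>The triangle axiom only speaks of a unit between two objects. After tensoring with the
  unit on the left, the claim follows from the pentagon and two triangles;
  \<open>lunit_faithful\<close> removes the additional unit.\<close>

lemma lunit_tensor:
  assumes [simp]: "X \<in> Obj C" "Y \<in> Obj C"
  shows "\<l> (X \<odot> Y) \<cdot> \<a> \<I> X Y = \<l> X \<otimes> \<one> Y"
proof (rule lunit_faithful)
  let ?p = "\<a> \<I> (\<I> \<odot> X) Y \<cdot> \<a> \<I> \<I> X \<otimes> \<one> Y"
  have "\<one> \<I> \<otimes> (\<l> (X \<odot> Y) \<cdot> \<a> \<I> X Y) \<cdot> ?p = \<one> \<I> \<otimes> \<l> (X \<odot> Y) \<cdot> \<one> \<I> \<otimes> \<a> \<I> X Y \<cdot> ?p"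
    by (simp add: tensor_comp'_assoc)
  also have "\<dots> = (\<one> \<I> \<otimes> \<l> (X \<odot> Y) \<cdot> \<a> \<I> \<I> (X \<odot> Y)) \<cdot> \<a> (\<I> \<odot> \<I>) X Y"
    by (simp add: pentagon)
  also have "\<dots> = \<r> \<I> \<otimes> (\<one> X \<otimes> \<one> Y) \<cdot> \<a> (\<I> \<odot> \<I>) X Y"
    by (simp add: triangle del: comp_assoc')
  also have "\<dots> = \<a> \<I> X Y \<cdot> (\<r> \<I> \<otimes> \<one> X) \<otimes> \<one> Y"
    using assoc_natural'[of "\<r> \<I>" "\<one> X" "\<one> Y"] by simp
  also have "\<dots> = \<a> \<I> X Y \<cdot> (\<one> \<I> \<otimes> \<l> X) \<otimes> \<one> Y \<cdot> \<a> \<I> \<I> X \<otimes> \<one> Y"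
    by (simp add: tensor_comp' triangle)
  also have "\<dots> = \<one> \<I> \<otimes> (\<l> X \<otimes> \<one> Y) \<cdot> ?p"
    using assoc_natural'[of "\<one> \<I>" "\<l> X" "\<one> Y"] by (simp flip: comp_assoc')
  finally show "\<one> \<I> \<otimes> (\<l> (X \<odot> Y) \<cdot> \<a> \<I> X Y) = \<one> \<I> \<otimes> (\<l> X \<otimes> \<one> Y)"
    by (rule iso_cancel_right) simp_all
qed (simp_all add: hom_def)

lemma runit_tensor:
  assumes [simp]: "X \<in> Obj C" "Y \<in> Obj C"
  shows "\<one> X \<otimes> \<r> Y \<cdot> \<a> X Y \<I> = \<r> (X \<odot> Y)"
proof (rule runit_faithful)
  have "\<a> X Y \<I> \<cdot> \<r> (X \<odot> Y) \<otimes> \<one> \<I> = \<a> X Y \<I> \<cdot> (\<one> X \<otimes> \<one> Y) \<otimes> \<l> \<I> \<cdot> \<a> (X \<odot> Y) \<I> \<I>"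
    by (simp add: triangle)
  also have "\<dots> = \<one> X \<otimes> (\<one> Y \<otimes> \<l> \<I>) \<cdot> \<a> X Y (\<I> \<odot> \<I>) \<cdot> \<a> (X \<odot> Y) \<I> \<I>"
    using assoc_natural'[of "\<one> X" "\<one> Y" "\<l> \<I>"] by (simp flip: comp_assoc' del: tensor_ident)
  also have "\<dots> = \<one> X \<otimes> (\<one> Y \<otimes> \<l> \<I>) \<cdot> \<one> X \<otimes> \<a> Y \<I> \<I> \<cdot> \<a> X (Y \<odot> \<I>) \<I> \<cdot> \<a> X Y \<I> \<otimes> \<one> \<I>"
    by (simp add: pentagon)
  also have "\<dots> = \<one> X \<otimes> (\<r> Y \<otimes> \<one> \<I>) \<cdot> \<a> X (Y \<odot> \<I>) \<I> \<cdot> \<a> X Y \<I> \<otimes> \<one> \<I>"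
    by (simp add: tensor_comp'_assoc triangle)
  also have "\<dots> = \<a> X Y \<I> \<cdot> (\<one> X \<otimes> \<r> Y) \<otimes> \<one> \<I> \<cdot> \<a> X Y \<I> \<otimes> \<one> \<I>"
    using assoc_natural'[of "\<one> X" "\<r> Y" "\<one> \<I>"] by (simp flip: comp_assoc')
  also have "\<dots> = \<a> X Y \<I> \<cdot> (\<one> X \<otimes> \<r> Y \<cdot> \<a> X Y \<I>) \<otimes> \<one> \<I>"
    by (simp add: tensor_comp')
  finally show "(\<one> X \<otimes> \<r> Y \<cdot> \<a> X Y \<I>) \<otimes> \<one> \<I> = \<r> (X \<odot> Y) \<otimes> \<one> \<I>"
    by (rule iso_cancel_left[OF sym]) simp_all
qed (simp_all add: hom_def)

text \<open>Naturality of the left unit constraint at its own component on the unit identifies the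
  two ways of deleting a unit from the left of a product. This makes \<open>lunit_tensor\<close> and
  the triangle comparable.\<close>

lemma lunit_unit: "\<l> \<I> = \<r> \<I>"
proof (rule runit_faithful)
  have "\<l> \<I> \<cdot> \<one> \<I> \<otimes> \<l> \<I> = \<l> \<I> \<cdot> \<l> (\<I> \<odot> \<I>)"
    by (rule lunit_natural) (simp add: hom_def)
  then have "\<one> \<I> \<otimes> \<l> \<I> = \<l> (\<I> \<odot> \<I>)"
    by (rule iso_cancel_left) simp_all
  then show "\<l> \<I> \<otimes> \<one> \<I> = \<r> \<I> \<otimes> \<one> \<I>"
    using lunit_tensor[of \<I> \<I>] triangle[of \<I> \<I>] by simp
qed (simp_all add: hom_def)

end

section \<open>The inverse braiding and non-degeneracy of the opposite multiplication\<close>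

context braided_monoidal_category
begin

lemma arr_braid [simp]:
  assumes "X \<in> Obj C" "Y \<in> Obj C"
  shows "iso C (\<c> X Y)" "\<c> X Y \<in> Arr C" "Dom C (\<c> X Y) = X \<odot> Y" "Cod C (\<c> X Y) = Y \<odot> X"
  using homD[OF braid_hom[OF assms]] braid_iso[OF assms] by simp_all

lemma arr_inv_braid [simp]:
  assumes "X \<in> Obj C" "Y \<in> Obj C"
  shows "iso C (\<c>\<^sup>- X Y)" "\<c>\<^sup>- X Y \<in> Arr C" "Dom C (\<c>\<^sup>- X Y) = X \<odot> Y" "Cod C (\<c>\<^sup>- X Y) = Y \<odot> X"
    "\<c> X Y \<cdot> \<c>\<^sup>- Y X = \<one> (Y \<odot> X)" "\<c>\<^sup>- X Y \<cdot> \<c> Y X = \<one> (Y \<odot> X)"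
  using assms by (simp_all add: inv_braid_def)

lemma inv_braid_cancel [simp]:
  assumes "X \<in> Obj C" "Y \<in> Obj C" "h \<in> Arr C" "Cod C h = Y \<odot> X"
  shows "\<c> X Y \<cdot> \<c>\<^sup>- Y X \<cdot> h = h" "\<c>\<^sup>- X Y \<cdot> \<c> Y X \<cdot> h = h"
  using assms by (simp_all add: inv_braid_def)

lemma inv_braid_natural:
  assumes "f \<in> Arr C" "g \<in> Arr C"
  shows "\<c>\<^sup>- (Cod C f) (Cod C g) \<cdot> f \<otimes> g = g \<otimes> f \<cdot> \<c>\<^sup>- (Dom C f) (Dom C g)"
proof (rule iso_cancel_left[OF _ arr_braid(1)])
  have "\<c> (Cod C g) (Cod C f) \<cdot> g \<otimes> f \<cdot> \<c>\<^sup>- (Dom C f) (Dom C g)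
      = (f \<otimes> g \<cdot> \<c> (Dom C g) (Dom C f)) \<cdot> \<c>\<^sup>- (Dom C f) (Dom C g)"
    using braid_natural[OF homI homI, OF assms(2,1)] assms by (simp flip: comp_assoc')
  then show "\<c> (Cod C g) (Cod C f) \<cdot> \<c>\<^sup>- (Cod C f) (Cod C g) \<cdot> f \<otimes> g
      = \<c> (Cod C g) (Cod C f) \<cdot> g \<otimes> f \<cdot> \<c>\<^sup>- (Dom C f) (Dom C g)"
    using assms by simp
qed (use assms in simp_all)

lemma inv_hexagon:
  assumes [simp]: "X \<in> Obj C" "Y \<in> Obj C" "Z \<in> Obj C"
  shows "\<a> X Y Z \<cdot> \<c>\<^sup>- Y X \<otimes> \<one> Z \<cdot> \<a>\<^sup>- Y X Z \<cdot> \<one> Y \<otimes> \<c>\<^sup>- Z X \<cdot> \<a> Y Z X = \<c>\<^sup>- (Y \<odot> Z) X"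
proof (rule iso_cancel_left[OF _ arr_braid(1)[of X "Y \<odot> Z"]])
  let ?f = "\<c>\<^sup>- Y X \<otimes> \<one> Z \<cdot> \<a>\<^sup>- Y X Z \<cdot> \<one> Y \<otimes> \<c>\<^sup>- Z X \<cdot> \<a> Y Z X"
  have "\<a> Y Z X \<cdot> \<c> X (Y \<odot> Z) \<cdot> \<a> X Y Z \<cdot> ?f = (\<a> Y Z X \<cdot> \<c> X (Y \<odot> Z) \<cdot> \<a> X Y Z) \<cdot> ?f"
    by simp
  also have "\<dots> = \<a> Y Z X"
    by (subst hexagon) (simp_all add: tensor_comp'_assoc)
  finally have "\<a> Y Z X \<cdot> (\<c> X (Y \<odot> Z) \<cdot> \<a> X Y Z \<cdot> ?f) = \<a> Y Z X \<cdot> \<one> ((Y \<odot> Z) \<odot> X)"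
    by simp
  then have "\<c> X (Y \<odot> Z) \<cdot> \<a> X Y Z \<cdot> ?f = \<one> ((Y \<odot> Z) \<odot> X)"
    by (rule iso_cancel_left) simp_all
  then show "\<c> X (Y \<odot> Z) \<cdot> \<a> X Y Z \<cdot> ?f = \<c> X (Y \<odot> Z) \<cdot> \<c>\<^sup>- (Y \<odot> Z) X"
    by simp
qed simp_all

lemma inv_hexagon':
  assumes [simp]: "X \<in> Obj C" "Y \<in> Obj C" "Z \<in> Obj C"
  shows "\<a>\<^sup>- X Y Z \<cdot> \<one> X \<otimes> \<c>\<^sup>- Z Y \<cdot> \<a> X Z Y \<cdot> \<c>\<^sup>- Z X \<otimes> \<one> Y \<cdot> \<a>\<^sup>- Z X Y = \<c>\<^sup>- Z (X \<odot> Y)"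
proof (rule iso_cancel_left[OF _ arr_braid(1)[of "X \<odot> Y" Z]])
  let ?f = "\<one> X \<otimes> \<c>\<^sup>- Z Y \<cdot> \<a> X Z Y \<cdot> \<c>\<^sup>- Z X \<otimes> \<one> Y \<cdot> \<a>\<^sup>- Z X Y"
  have "\<a>\<^sup>- Z X Y \<cdot> \<c> (X \<odot> Y) Z \<cdot> \<a>\<^sup>- X Y Z \<cdot> ?f = (\<a>\<^sup>- Z X Y \<cdot> \<c> (X \<odot> Y) Z \<cdot> \<a>\<^sup>- X Y Z) \<cdot> ?f"
    by simp
  also have "\<dots> = \<a>\<^sup>- Z X Y"
    by (subst hexagon') (simp_all add: tensor_comp'_assoc)
  finally have "\<a>\<^sup>- Z X Y \<cdot> (\<c> (X \<odot> Y) Z \<cdot> \<a>\<^sup>- X Y Z \<cdot> ?f) = \<a>\<^sup>- Z X Y \<cdot> \<one> (Z \<odot> (X \<odot> Y))"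
    by simp
  then have "\<c> (X \<odot> Y) Z \<cdot> \<a>\<^sup>- X Y Z \<cdot> ?f = \<one> (Z \<odot> (X \<odot> Y))"
    by (rule iso_cancel_left) simp_all
  then show "\<c> (X \<odot> Y) Z \<cdot> \<a>\<^sup>- X Y Z \<cdot> ?f = \<c> (X \<odot> Y) Z \<cdot> \<c>\<^sup>- Z (X \<odot> Y)"
    by simp
qed simp_all

text \<open>Postcomposition with \<open>\<c>\<^sup>- Y A\<close> is a bijection between the arguments of the two
  injectivity conditions, and it carries one for \<open>m \<cdot> \<c>\<^sup>- A A\<close> to the other for \<open>m\<close>.\<close>

lemma nondegenerate_opposite:
  assumes A [simp]: "A \<in> Obj C" and m: "m \<in> hom C (A \<odot> A) A" and nd: "nondegenerate C A m"
  shows "nondegenerate C A (m \<cdot> \<c>\<^sup>- A A)"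
  unfolding nondegenerate_def
proof (intro ballI conjI inj_onI)
  note [simp] = homD[OF m]
  fix X Y assume [simp]: "X \<in> Obj C" "Y \<in> Obj C"
  {
    let ?F = "\<lambda>f. \<one> Y \<otimes> (m \<cdot> \<c>\<^sup>- A A) \<cdot> \<a> Y A A \<cdot> f \<otimes> \<one> A"
    let ?G = "\<lambda>g. m \<otimes> \<one> Y \<cdot> \<a>\<^sup>- A A Y \<cdot> \<one> A \<otimes> g"
    have *: "\<c>\<^sup>- Y A \<cdot> ?F f = ?G (\<c>\<^sup>- Y A \<cdot> f) \<cdot> \<c>\<^sup>- X A" if "f \<in> hom C X (Y \<odot> A)" for f
    proof -
      note [simp] = homD[OF that]
      let ?r = "\<one> Y \<otimes> \<c>\<^sup>- A A \<cdot> \<a> Y A A \<cdot> f \<otimes> \<one> A"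
      have "\<c>\<^sup>- Y A \<cdot> ?F f = (\<c>\<^sup>- Y A \<cdot> \<one> Y \<otimes> m) \<cdot> ?r"
        by (simp add: tensor_comp'_assoc)
      also have "\<dots> = m \<otimes> \<one> Y \<cdot> \<c>\<^sup>- Y (A \<odot> A) \<cdot> ?r"
        using inv_braid_natural[of "\<one> Y" m] by simp
      \<comment> \<open>The crossing of \<open>Y\<close> with the product is split in two. One part
        will be absorbed into the argument of \<open>?G\<close>; the other joins the crossing inside
        the opposite multiplication, and \<open>inv_hexagon\<close> fuses them into one crossing of
        \<open>Y \<odot> A\<close> with \<open>A\<close>.\<close>
      also have "\<dots> = m \<otimes> \<one> Y \<cdot> \<a>\<^sup>- A A Y \<cdot> \<one> A \<otimes> \<c>\<^sup>- Y A \<cdot>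
          (\<a> A Y A \<cdot> \<c>\<^sup>- Y A \<otimes> \<one> A \<cdot> \<a>\<^sup>- Y A A \<cdot> \<one> Y \<otimes> \<c>\<^sup>- A A \<cdot> \<a> Y A A) \<cdot> f \<otimes> \<one> A"
        by (simp flip: inv_hexagon')
      also have "\<dots> = m \<otimes> \<one> Y \<cdot> \<a>\<^sup>- A A Y \<cdot> \<one> A \<otimes> \<c>\<^sup>- Y A \<cdot> \<c>\<^sup>- (Y \<odot> A) A \<cdot> f \<otimes> \<one> A"
        by (simp only: inv_hexagon A \<open>Y \<in> Obj C\<close>)
      also have "\<dots> = ?G (\<c>\<^sup>- Y A \<cdot> f) \<cdot> \<c>\<^sup>- X A"
        using inv_braid_natural[of f "\<one> A"] by (simp add: tensor_comp'_assoc)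
      finally show ?thesis .
    qed
    fix f g assume fg: "f \<in> hom C X (Y \<odot> A)" "g \<in> hom C X (Y \<odot> A)" and "?F f = ?F g"
    then have "?G (\<c>\<^sup>- Y A \<cdot> f) \<cdot> \<c>\<^sup>- X A = ?G (\<c>\<^sup>- Y A \<cdot> g) \<cdot> \<c>\<^sup>- X A"
      using * by metis
    then have "?G (\<c>\<^sup>- Y A \<cdot> f) = ?G (\<c>\<^sup>- Y A \<cdot> g)"
      by (rule iso_cancel_right) (use homD[OF fg(1)] homD[OF fg(2)] in simp_all)
    moreover have "inj_on ?G (hom C X (A \<odot> Y))"
      using nd by (simp add: nondegenerate_def)
    moreover have "\<c>\<^sup>- Y A \<cdot> f \<in> hom C X (A \<odot> Y)" "\<c>\<^sup>- Y A \<cdot> g \<in> hom C X (A \<odot> Y)"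
      using homD[OF fg(1)] homD[OF fg(2)] by (simp_all add: hom_def)
    ultimately have "\<c>\<^sup>- Y A \<cdot> f = \<c>\<^sup>- Y A \<cdot> g"
      by (meson inj_onD)
    then show "f = g"
      by (rule iso_cancel_left) (use homD[OF fg(1)] homD[OF fg(2)] in simp_all)
  }
  {
    let ?F = "\<lambda>f. (m \<cdot> \<c>\<^sup>- A A) \<otimes> \<one> Y \<cdot> \<a>\<^sup>- A A Y \<cdot> \<one> A \<otimes> f"
    let ?G = "\<lambda>g. \<one> Y \<otimes> m \<cdot> \<a> Y A A \<cdot> g \<otimes> \<one> A"
    have *: "\<c>\<^sup>- A Y \<cdot> ?F f = ?G (\<c>\<^sup>- A Y \<cdot> f) \<cdot> \<c>\<^sup>- A X" if "f \<in> hom C X (A \<odot> Y)" for f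
    proof -
      note [simp] = homD[OF that]
      let ?r = "\<c>\<^sup>- A A \<otimes> \<one> Y \<cdot> \<a>\<^sup>- A A Y \<cdot> \<one> A \<otimes> f"
      have "\<c>\<^sup>- A Y \<cdot> ?F f = (\<c>\<^sup>- A Y \<cdot> m \<otimes> \<one> Y) \<cdot> ?r"
        by (simp add: tensor_comp'_assoc)
      also have "\<dots> = \<one> Y \<otimes> m \<cdot> \<c>\<^sup>- (A \<odot> A) Y \<cdot> ?r"
        using inv_braid_natural[of m "\<one> Y"] by simp
      also have "\<dots> = \<one> Y \<otimes> m \<cdot> \<a> Y A A \<cdot> \<c>\<^sup>- A Y \<otimes> \<one> A \<cdot>
          (\<a>\<^sup>- A Y A \<cdot> \<one> A \<otimes> \<c>\<^sup>- A Y \<cdot> \<a> A A Y \<cdot> \<c>\<^sup>- A A \<otimes> \<one> Y \<cdot> \<a>\<^sup>- A A Y) \<cdot> \<one> A \<otimes> f"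
        by (simp flip: inv_hexagon)
      also have "\<dots> = \<one> Y \<otimes> m \<cdot> \<a> Y A A \<cdot> \<c>\<^sup>- A Y \<otimes> \<one> A \<cdot> \<c>\<^sup>- A (A \<odot> Y) \<cdot> \<one> A \<otimes> f"
        by (simp only: inv_hexagon' A \<open>Y \<in> Obj C\<close>)
      also have "\<dots> = ?G (\<c>\<^sup>- A Y \<cdot> f) \<cdot> \<c>\<^sup>- A X"
        using inv_braid_natural[of "\<one> A" f] by (simp add: tensor_comp'_assoc)
      finally show ?thesis .
    qed
    fix f g assume fg: "f \<in> hom C X (A \<odot> Y)" "g \<in> hom C X (A \<odot> Y)" and "?F f = ?F g"
    then have "?G (\<c>\<^sup>- A Y \<cdot> f) \<cdot> \<c>\<^sup>- A X = ?G (\<c>\<^sup>- A Y \<cdot> g) \<cdot> \<c>\<^sup>- A X"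
      using * by metis
    then have "?G (\<c>\<^sup>- A Y \<cdot> f) = ?G (\<c>\<^sup>- A Y \<cdot> g)"
      by (rule iso_cancel_right) (use homD[OF fg(1)] homD[OF fg(2)] in simp_all)
    moreover have "inj_on ?G (hom C X (Y \<odot> A))"
      using nd by (simp add: nondegenerate_def)
    moreover have "\<c>\<^sup>- A Y \<cdot> f \<in> hom C X (Y \<odot> A)" "\<c>\<^sup>- A Y \<cdot> g \<in> hom C X (Y \<odot> A)"
      using homD[OF fg(1)] homD[OF fg(2)] by (simp_all add: hom_def)
    ultimately have "\<c>\<^sup>- A Y \<cdot> f = \<c>\<^sup>- A Y \<cdot> g"
      by (meson inj_onD)
    then show "f = g"
      by (rule iso_cancel_left) (use homD[OF fg(1)] homD[OF fg(2)] in simp_all)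
  }
qed

end

section \<open>The strict category of tensor powers\<close>

text \<open>Bracketings are syntactic because an object may be a bracketed power of \<open>A\<close>
  in several ways, and the isomorphism to normal form depends on the way.\<close>

datatype bracketing = Leaf | Unit | Node bracketing bracketing

primrec leaves :: "bracketing \<Rightarrow> nat" where
  "leaves Leaf = 1"
| "leaves Unit = 0"
| "leaves (Node b b') = leaves b + leaves b'"

primrec right_comb :: "nat \<Rightarrow> bracketing" where
  "right_comb 0 = Unit"
| "right_comb (Suc n) = Node Leaf (right_comb n)"

lemma leaves_right_comb [simp]: "leaves (right_comb n) = n"
  by (induction n) simp_all

locale tensor_powers = braided_monoidal_category +
  fixes A
  assumes base [simp]: "A \<in> Obj C"
begin

text \<open>Every power ends in a unit. In particular the first power is
  \<open>A \<odot> \<I>\<close> and not \<open>A\<close>, which makes the recursion uniform.\<close>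

primrec pow :: "nat \<Rightarrow> 'a" where
  "pow 0 = \<I>"
| "pow (Suc n) = A \<odot> pow n"

lemma pow_obj [simp]: "pow n \<in> Obj C"
  by (induction n) simp_all

lemma pow_1 [simp]: "pow 1 = A \<odot> \<I>"
  by (simp add: One_nat_def)

primrec pow_add :: "nat \<Rightarrow> nat \<Rightarrow> 'b" where
  "pow_add 0 n = \<l> (pow n)"
| "pow_add (Suc m) n = \<one> A \<otimes> pow_add m n \<cdot> \<a> A (pow m) (pow n)"

lemma iso_pow_add: "iso C (pow_add m n) \<and> pow_add m n \<in> hom C (pow m \<odot> pow n) (pow (m + n))"
  by (induction m) (simp_all add: hom_def)

lemma pow_add [simp]:
  "iso C (pow_add m n)" "pow_add m n \<in> Arr C"
  "Dom C (pow_add m n) = pow m \<odot> pow n" "Cod C (pow_add m n) = pow (m + n)"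
  using iso_pow_add[of m n] by (simp_all add: hom_def)

lemma pow_add_0_right: "pow_add m 0 = \<r> (pow m)"
  by (induction m) (simp_all add: lunit_unit runit_tensor)

text \<open>The core of the coherence argument: the induction step is the pentagon together with
  naturality of the associativity constraint. It is the reason why associativity constraints become
  identities in the strict category.\<close>

lemma pow_add_assoc:
  "pow_add (m + n) k \<cdot> pow_add m n \<otimes> \<one> (pow k)
    = pow_add m (n + k) \<cdot> \<one> (pow m) \<otimes> pow_add n k \<cdot> \<a> (pow m) (pow n) (pow k)"
proof (induction m)
  case 0
  have "\<l> (pow (n + k)) \<cdot> \<one> \<I> \<otimes> pow_add n k = pow_add n k \<cdot> \<l> (pow n \<odot> pow k)"
    by (rule lunit_natural) (simp add: hom_def)
  then have "\<l> (pow (n + k)) \<cdot> \<one> \<I> \<otimes> pow_add n k \<cdot> \<a> \<I> (pow n) (pow k)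
      = pow_add n k \<cdot> \<l> (pow n \<odot> pow k) \<cdot> \<a> \<I> (pow n) (pow k)"
    by (simp flip: comp_assoc')
  then show ?case
    by (simp add: lunit_tensor)
next
  case (Suc m)
  let ?A = "\<one> A" and ?k = "\<one> (pow k)"
  have "pow_add (Suc m + n) k \<cdot> pow_add (Suc m) n \<otimes> ?k
      = ?A \<otimes> pow_add (m + n) k \<cdot> (\<a> A (pow (m + n)) (pow k) \<cdot> (?A \<otimes> pow_add m n) \<otimes> ?k)
          \<cdot> \<a> A (pow m) (pow n) \<otimes> ?k"
    using tensor_comp'[of "\<a> A (pow m) (pow n)" "?A \<otimes> pow_add m n" ?k ?k] by simp
  also have "\<dots> = ?A \<otimes> (pow_add (m + n) k \<cdot> pow_add m n \<otimes> ?k)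
      \<cdot> \<a> A (pow m \<odot> pow n) (pow k) \<cdot> \<a> A (pow m) (pow n) \<otimes> ?k"
    using assoc_natural'[of ?A "pow_add m n" ?k] by (simp add: tensor_comp'_assoc)
  also have "\<dots> = ?A \<otimes> (pow_add m (n + k) \<cdot> \<one> (pow m) \<otimes> pow_add n k)
      \<cdot> ?A \<otimes> \<a> (pow m) (pow n) (pow k) \<cdot> \<a> A (pow m \<odot> pow n) (pow k) \<cdot> \<a> A (pow m) (pow n) \<otimes> ?k"
    by (simp add: Suc.IH tensor_comp'_assoc)
  also have "\<dots> = ?A \<otimes> pow_add m (n + k) \<cdot> (?A \<otimes> (\<one> (pow m) \<otimes> pow_add n k)
      \<cdot> \<a> A (pow m) (pow n \<odot> pow k)) \<cdot> \<a> (A \<odot> pow m) (pow n) (pow k)"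
    by (simp add: pentagon tensor_comp'_assoc)
  also have "?A \<otimes> (\<one> (pow m) \<otimes> pow_add n k) \<cdot> \<a> A (pow m) (pow n \<odot> pow k)
      = \<a> A (pow m) (pow (n + k)) \<cdot> \<one> (pow (Suc m)) \<otimes> pow_add n k"
    using assoc_natural'[of ?A "\<one> (pow m)" "pow_add n k"] by simp
  also have "?A \<otimes> pow_add m (n + k) \<cdot> (\<dots>) \<cdot> \<a> (A \<odot> pow m) (pow n) (pow k)
      = pow_add (Suc m) (n + k) \<cdot> \<one> (pow (Suc m)) \<otimes> pow_add n k \<cdot> \<a> (pow (Suc m)) (pow n) (pow k)"
    by simp
  finally show ?case .
qed

primrec obj_of :: "bracketing \<Rightarrow> 'a" where
  "obj_of Leaf = A"
| "obj_of Unit = \<I>"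
| "obj_of (Node b b') = obj_of b \<odot> obj_of b'"

lemma obj_of [simp]: "obj_of b \<in> Obj C"
  by (induction b) simp_all

lemma obj_of_right_comb [simp]: "obj_of (right_comb n) = pow n"
  by (induction n) simp_all

text \<open>The canonical isomorphism to normal form. A single leaf still has to acquire the unit at
  the end of \<open>pow 1\<close>.\<close>

primrec flatten :: "bracketing \<Rightarrow> 'b" where
  "flatten Leaf = inverse_arr C (\<r> A)"
| "flatten Unit = \<one> \<I>"
| "flatten (Node b b') = pow_add (leaves b) (leaves b') \<cdot> flatten b \<otimes> flatten b'"

lemma iso_flatten: "iso C (flatten b) \<and> flatten b \<in> hom C (obj_of b) (pow (leaves b))"
  by (induction b) (simp_all add: hom_def)

lemma flatten [simp]:
  "iso C (flatten b)" "flatten b \<in> Arr C"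
  "Dom C (flatten b) = obj_of b" "Cod C (flatten b) = pow (leaves b)"
  using iso_flatten[of b] by (simp_all add: hom_def)

text \<open>Consequently an arrow between powers is its own strict version, and laws of
  \<open>C\<close> can be specialized to laws of the strict category.\<close>

lemma flatten_right_comb [simp]: "flatten (right_comb n) = \<one> (pow n)"
proof (induction n)
  case (Suc n)
  \<comment> \<open>By the triangle, adjoining a first strand deletes exactly the unit that
    \<open>flatten Leaf\<close> inserts.\<close>
  have "pow_add 1 n = \<r> A \<otimes> \<one> (pow n)"
    using triangle[of A "pow n"] by (simp add: One_nat_def)
  with Suc show ?case
    by (simp add: tensor_comp')
qed simp

abbreviation unflatten :: "bracketing \<Rightarrow> 'b" where
  "unflatten b \<equiv> inverse_arr C (flatten b)"

text \<open>The exponents are recorded because distinct powers may be equal as objects.\<close>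

type_synonym 'm pow_arr = "(nat \<times> 'm \<times> nat) option"

definition arr :: "'b pow_arr \<Rightarrow> bool" where
  "arr F \<longleftrightarrow> (\<exists>m f n. F = Some (m, f, n) \<and> f \<in> hom C (pow m) (pow n))"

definition dm :: "'b pow_arr \<Rightarrow> nat" where "dm F = fst (the F)"
definition cd :: "'b pow_arr \<Rightarrow> nat" where "cd F = snd (snd (the F))"

definition idn :: "nat \<Rightarrow> 'b pow_arr" where
  "idn n = Some (n, \<one> (pow n), n)"

definition cmp :: "'b pow_arr \<Rightarrow> 'b pow_arr \<Rightarrow> 'b pow_arr"  (infixr "\<bullet>" 70) where
  "G \<bullet> F = (if arr F \<and> arr G \<and> dm G = cd F
     then Some (dm F, fst (snd (the G)) \<cdot> fst (snd (the F)), cd G) else None)"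

definition tns :: "'b pow_arr \<Rightarrow> 'b pow_arr \<Rightarrow> 'b pow_arr"  (infixr "\<boxtimes>" 75) where
  "F \<boxtimes> G = Some (dm F + dm G,
     pow_add (cd F) (cd G) \<cdot> fst (snd (the F)) \<otimes> fst (snd (the G)) \<cdot> inverse_arr C (pow_add (dm F) (dm G)),
     cd F + cd G)"

definition br :: "nat \<Rightarrow> nat \<Rightarrow> 'b pow_arr" where
  "br m n = Some (m + n, pow_add n m \<cdot> \<c> (pow m) (pow n) \<cdot> inverse_arr C (pow_add m n), n + m)"

definition bri :: "nat \<Rightarrow> nat \<Rightarrow> 'b pow_arr" where
  "bri m n = Some (m + n, pow_add n m \<cdot> \<c>\<^sup>- (pow m) (pow n) \<cdot> inverse_arr C (pow_add m n), n + m)"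

definition strict :: "bracketing \<Rightarrow> bracketing \<Rightarrow> 'b \<Rightarrow> 'b pow_arr" where
  "strict b b' f = Some (leaves b, flatten b' \<cdot> f \<cdot> unflatten b, leaves b')"

text \<open>A relation instead of a function, so that strict versions can be derived by resolution
  along the structure of an arrow, with the intermediate bracketings synthesized on the way. Then
  \<open>rep_eqD\<close> and \<open>rep_eqI\<close> move equations between the two worlds.\<close>

definition rep :: "bracketing \<Rightarrow> bracketing \<Rightarrow> 'b \<Rightarrow> 'b pow_arr \<Rightarrow> bool" where
  "rep b b' f F \<longleftrightarrow> f \<in> hom C (obj_of b) (obj_of b') \<and> F = strict b b' f"

lemma rep_D:
  assumes "rep b b' f F"
  shows "f \<in> Arr C" "Dom C f = obj_of b" "Cod C f = obj_of b'" "arr F" "dm F = leaves b" "cd F = leaves b'"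
  using assms by (simp_all add: rep_def strict_def arr_def dm_def cd_def hom_def)

lemma rep_strict: "f \<in> hom C (obj_of b) (obj_of b') \<Longrightarrow> rep b b' f (strict b b' f)"
  by (simp add: rep_def)

lemma rep_eqD: "f = g \<Longrightarrow> rep b b' f F \<Longrightarrow> rep b b' g G \<Longrightarrow> F = G"
  by (simp add: rep_def)

lemma rep_eqI:
  assumes "rep b b' f F" "rep b b' g G" "F = G"
  shows "f = g"
proof -
  note [simp] = rep_D(1-3)[OF assms(1)] rep_D(1-3)[OF assms(2)]
  have "flatten b' \<cdot> f \<cdot> unflatten b = flatten b' \<cdot> g \<cdot> unflatten b"
    using assms by (simp add: rep_def strict_def)
  then have "f \<cdot> unflatten b = g \<cdot> unflatten b"
    by (rule iso_cancel_left) simp_all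
  then show ?thesis
    by (rule iso_cancel_right) simp_all
qed

lemma arr_rep:
  assumes "arr F"
  obtains f where "rep (right_comb (dm F)) (right_comb (cd F)) f F"
proof -
  from assms obtain m f n where F: "F = Some (m, f, n)" "f \<in> hom C (pow m) (pow n)"
    by (auto simp: arr_def)
  with homD[OF F(2)] have "rep (right_comb (dm F)) (right_comb (cd F)) f F"
    by (simp add: rep_def strict_def dm_def cd_def hom_def)
  then show thesis ..
qed

lemma rep_comp:
  assumes "rep b' b'' g G" "rep b b' f F"
  shows "rep b b'' (g \<cdot> f) (G \<bullet> F)"
proof -
  note [simp] = rep_D[OF assms(1)] rep_D[OF assms(2)]
  have "(flatten b'' \<cdot> g \<cdot> unflatten b') \<cdot> (flatten b' \<cdot> f \<cdot> unflatten b) = flatten b'' \<cdot> (g \<cdot> f) \<cdot> unflatten b"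
    by simp
  then show ?thesis
    using assms rep_D(4-6)[OF assms(1)] rep_D(4-6)[OF assms(2)]
    by (simp add: rep_def strict_def cmp_def hom_def)
qed

lemma rep_tensor:
  assumes "rep a a' f F" "rep b b' g G"
  shows "rep (Node a b) (Node a' b') (f \<otimes> g) (F \<boxtimes> G)"
proof -
  note [simp] = rep_D[OF assms(1)] rep_D[OF assms(2)]
  let ?\<phi> = "pow_add (leaves a) (leaves b)" and ?\<psi> = "pow_add (leaves a') (leaves b')"
  have "?\<psi> \<cdot> (flatten a' \<cdot> f \<cdot> unflatten a) \<otimes> (flatten b' \<cdot> g \<cdot> unflatten b) \<cdot> inverse_arr C ?\<phi>
      = ?\<psi> \<cdot> flatten a' \<otimes> flatten b' \<cdot> f \<otimes> g \<cdot> unflatten a \<otimes> unflatten b \<cdot> inverse_arr C ?\<phi>"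
    by (simp add: tensor_comp'_assoc)
  then show ?thesis
    using assms by (simp add: rep_def tns_def strict_def hom_def dm_def cd_def)
qed

lemma rep_ident: "X = obj_of b \<Longrightarrow> rep b b (\<one> X) (idn (leaves b))"
  by (simp add: rep_def idn_def strict_def hom_def)

lemma rep_braid: "X = obj_of b \<Longrightarrow> Y = obj_of b' \<Longrightarrow>
    rep (Node b b') (Node b' b) (\<c> X Y) (br (leaves b) (leaves b'))"
  using comp_eq_assoc[OF braid_natural[OF homI homI, of "flatten b" "flatten b'"],
      of "unflatten b \<otimes> unflatten b' \<cdot> inverse_arr C (pow_add (leaves b) (leaves b'))", symmetric]
  by (simp add: rep_def br_def strict_def hom_def tensor_comp' tensor_comp'_assoc)

lemma rep_inv_braid: "X = obj_of b \<Longrightarrow> Y = obj_of b' \<Longrightarrow>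
    rep (Node b b') (Node b' b) (\<c>\<^sup>- X Y) (bri (leaves b) (leaves b'))"
  using comp_eq_assoc[OF inv_braid_natural[of "flatten b" "flatten b'"],
      of "unflatten b \<otimes> unflatten b' \<cdot> inverse_arr C (pow_add (leaves b) (leaves b'))", symmetric]
  by (simp add: rep_def bri_def strict_def hom_def tensor_comp' tensor_comp'_assoc)

text \<open>Structural isomorphisms are those with trivial strict version.\<close>

definition coherence :: "bracketing \<Rightarrow> bracketing \<Rightarrow> 'b \<Rightarrow> bool" where
  "coherence b b' k \<longleftrightarrow> k \<in> hom C (obj_of b) (obj_of b') \<and> leaves b = leaves b' \<and> flatten b' \<cdot> k = flatten b"

lemma coherence_D:
  assumes "coherence b b' k"
  shows "k = unflatten b' \<cdot> flatten b" "leaves b = leaves b'"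
proof -
  have k: "k \<in> hom C (obj_of b) (obj_of b')" "flatten b' \<cdot> k = flatten b"
    using assms by (simp_all add: coherence_def)
  then have "unflatten b' \<cdot> flatten b' \<cdot> k = unflatten b' \<cdot> flatten b"
    by simp
  then show "k = unflatten b' \<cdot> flatten b"
    using homD[OF k(1)] by simp
  show "leaves b = leaves b'"
    using assms by (simp add: coherence_def)
qed

lemma rep_comp_coherence:
  assumes "coherence b b' k"
  shows "rep b' b'' f F \<Longrightarrow> rep b b'' (f \<cdot> k) F" "rep b'' b f F \<Longrightarrow> rep b'' b' (k \<cdot> f) F"
proof -
  note k = coherence_D[OF assms]
  show "rep b b'' (f \<cdot> k) F" if f: "rep b' b'' f F"
    using f rep_D(1-3)[OF f] k(2) unfolding k(1) by (simp add: rep_def strict_def hom_def)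
  show "rep b'' b' (k \<cdot> f) F" if f: "rep b'' b f F"
    using f rep_D(1-3)[OF f] k(2) unfolding k(1) by (simp add: rep_def strict_def hom_def)
qed

lemma coherence_assoc:
  assumes "X = obj_of b" "Y = obj_of b'" "Z = obj_of b''"
  shows "coherence (Node (Node b b') b'') (Node b (Node b' b'')) (\<a> X Y Z)"
proof -
  let ?n = "leaves b" and ?n' = "leaves b'" and ?n'' = "leaves b''"
  have "flatten (Node b (Node b' b'')) \<cdot> \<a> X Y Z
      = pow_add ?n (?n' + ?n'') \<cdot> \<one> (pow ?n) \<otimes> pow_add ?n' ?n''
        \<cdot> flatten b \<otimes> (flatten b' \<otimes> flatten b'') \<cdot> \<a> X Y Z"
    using assms by (simp add: tensor_comp'_assoc)
  also have "\<dots> = pow_add ?n (?n' + ?n'') \<cdot> \<one> (pow ?n) \<otimes> pow_add ?n' ?n''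
        \<cdot> \<a> (pow ?n) (pow ?n') (pow ?n'') \<cdot> (flatten b \<otimes> flatten b') \<otimes> flatten b''"
    using assoc_natural'[of "flatten b" "flatten b'" "flatten b''"] assms by simp
  also have "\<dots> = (pow_add ?n (?n' + ?n'') \<cdot> \<one> (pow ?n) \<otimes> pow_add ?n' ?n''
        \<cdot> \<a> (pow ?n) (pow ?n') (pow ?n'')) \<cdot> (flatten b \<otimes> flatten b') \<otimes> flatten b''"
    by simp
  also have "\<dots> = flatten (Node (Node b b') b'')"
    by (simp add: tensor_comp' flip: pow_add_assoc)
  finally show ?thesis
    using assms by (simp add: coherence_def hom_def)
qed

lemma coherence_inverse:
  assumes "coherence b b' k"
  shows "coherence b' b (inverse_arr C k)"
  using coherence_D[OF assms] by (simp add: coherence_def hom_def)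

lemma coherence_inv_assoc: "X = obj_of b \<Longrightarrow> Y = obj_of b' \<Longrightarrow> Z = obj_of b'' \<Longrightarrow>
    coherence (Node b (Node b' b'')) (Node (Node b b') b'') (\<a>\<^sup>- X Y Z)"
  unfolding inv_assoc_def by (intro coherence_inverse coherence_assoc)

lemma coherence_lunit: "X = obj_of b \<Longrightarrow> coherence (Node Unit b) b (\<l> X)"
  using lunit_natural[OF homI[of "flatten b"]] by (simp add: coherence_def hom_def)

lemma coherence_runit: "X = obj_of b \<Longrightarrow> coherence (Node b Unit) b (\<r> X)"
  using runit_natural[OF homI[of "flatten b"]]
  by (simp add: coherence_def hom_def pow_add_0_right)

lemma coherence_ident_tensor:
  assumes "coherence b b' k"
  shows "coherence (Node Leaf b) (Node Leaf b') (\<one> A \<otimes> k)"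
  using coherence_D[OF assms]
  by (simp add: coherence_def hom_def tensor_comp')

lemma coherence_comp:
  assumes "coherence b' b'' k'" "coherence b b' k"
  shows "coherence b b'' (k' \<cdot> k)"
  using coherence_D[OF assms(1)] coherence_D[OF assms(2)] by (simp add: coherence_def hom_def)

text \<open>A constraint is absorbed by the arrow next to it and leaves no factor in the strict
  version; the rule lists therefore try these rules before \<open>rep_comp\<close>. The first rule
  serves the comultiplicativity axioms, whose left sides end in two consecutive constraints.\<close>

lemmas rep_structural =
  rep_comp_coherence(1)[OF coherence_comp
    [OF coherence_ident_tensor[OF coherence_inv_assoc] coherence_assoc]]
  rep_comp_coherence[OF coherence_assoc] rep_comp_coherence[OF coherence_inv_assoc]
  rep_comp_coherence[OF coherence_lunit] rep_comp_coherence[OF coherence_runit]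
  rep_comp_coherence[OF coherence_ident_tensor[OF coherence_assoc]]
  rep_comp_coherence[OF coherence_ident_tensor[OF coherence_inv_assoc]]

lemma obj_of_eqs:
  "A = obj_of Leaf" "\<I> = obj_of Unit" "pow n = obj_of (right_comb n)"
  "X = obj_of b \<Longrightarrow> Y = obj_of b' \<Longrightarrow> X \<odot> Y = obj_of (Node b b')"
  by simp_all

lemma rep_ident_pow: "rep (right_comb n) (right_comb n) (\<one> (pow n)) (idn n)"
  using rep_ident[of "pow n" "right_comb n"] by simp

lemma rep_braid_pow:
  "rep (Node (right_comb m) (right_comb n)) (Node (right_comb n) (right_comb m))
    (\<c> (pow m) (pow n)) (br m n)"
  "rep (Node (right_comb m) (right_comb n)) (Node (right_comb n) (right_comb m))
    (\<c>\<^sup>- (pow m) (pow n)) (bri m n)"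
  using rep_braid[of _ "right_comb m" _ "right_comb n"]
    rep_inv_braid[of _ "right_comb m" _ "right_comb n"] by simp_all

section \<open>The laws of the strict category, each the strict version of a law of
  \<open>C\<close>\<close>

lemma cmp_assoc: "(H \<bullet> G) \<bullet> F = H \<bullet> G \<bullet> F"
proof (cases "arr F \<and> arr G \<and> arr H \<and> dm G = cd F \<and> dm H = cd G")
  case True
  then obtain f g h where "rep (right_comb (dm F)) (right_comb (cd F)) f F"
    "rep (right_comb (cd F)) (right_comb (cd G)) g G"
    "rep (right_comb (cd G)) (right_comb (cd H)) h H"
    using arr_rep by metis
  note reps = this
  note rep_D(1-3)[OF reps(1), simp] rep_D(1-3)[OF reps(2), simp] rep_D(1-3)[OF reps(3), simp]
  have "(h \<cdot> g) \<cdot> f = h \<cdot> g \<cdot> f"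
    by simp
  then show ?thesis
    by (rule rep_eqD) (rule reps rep_comp)+
next
  case False
  \<comment> \<open>A composite is an arrow exactly when its factors compose. Hence if the three
    arrows do not compose, both bracketings are \<open>None\<close>.\<close>
  have "arr (K \<bullet> L) \<longleftrightarrow> arr K \<and> arr L \<and> dm K = cd L" for K L
    by (auto simp: cmp_def arr_def dm_def cd_def hom_def)
  with False show ?thesis
    by (auto simp: cmp_def dm_def cd_def split: if_splits)
qed

lemma arr_homE:
  assumes "arr F"
  obtains f where "f \<in> hom C (pow (dm F)) (pow (cd F))" "rep (right_comb (dm F)) (right_comb (cd F)) f F"
proof -
  obtain f where f: "rep (right_comb (dm F)) (right_comb (cd F)) f F"
    using assms by (rule arr_rep)
  then have "f \<in> hom C (pow (dm F)) (pow (cd F))"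
    by (simp add: rep_def)
  then show thesis
    using f ..
qed

text \<open>This is naturality of the associativity constraint, whose strict version has lost the
  constraints. In the same way the unit laws come from naturality of the unit constraints.\<close>

lemma tns_assoc:
  assumes "arr F" "arr G" "arr H"
  shows "(F \<boxtimes> G) \<boxtimes> H = F \<boxtimes> G \<boxtimes> H"
proof -
  from assms obtain f g h where
    "f \<in> hom C (pow (dm F)) (pow (cd F))" "g \<in> hom C (pow (dm G)) (pow (cd G))"
    "h \<in> hom C (pow (dm H)) (pow (cd H))"
    and reps: "rep (right_comb (dm F)) (right_comb (cd F)) f F"
    "rep (right_comb (dm G)) (right_comb (cd G)) g G" "rep (right_comb (dm H)) (right_comb (cd H)) h H"
    by (meson arr_homE)
  then show ?thesis
    by (intro rep_eqD[OF assoc_natural])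
      (assumption | rule reps rep_structural obj_of_eqs rep_comp rep_tensor)+
qed

lemma tns_cmp:
  assumes "arr F" "arr F'" "arr G" "arr G'" "dm F' = cd F" "dm G' = cd G"
  shows "(F' \<bullet> F) \<boxtimes> (G' \<bullet> G) = F' \<boxtimes> G' \<bullet> F \<boxtimes> G"
proof -
  from assms obtain f f' g g' where
    "f \<in> hom C (pow (dm F)) (pow (cd F))" "f' \<in> hom C (pow (cd F)) (pow (cd F'))"
    "g \<in> hom C (pow (dm G)) (pow (cd G))" "g' \<in> hom C (pow (cd G)) (pow (cd G'))"
    and reps: "rep (right_comb (dm F)) (right_comb (cd F)) f F"
    "rep (right_comb (cd F)) (right_comb (cd F')) f' F'"
    "rep (right_comb (dm G)) (right_comb (cd G)) g G"
    "rep (right_comb (cd G)) (right_comb (cd G')) g' G'"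
    by (metis arr_homE)
  then show ?thesis
    by (intro rep_eqD[OF tensor_comp]) (assumption | rule reps rep_comp rep_tensor)+
qed

lemma tns_idn: "idn m \<boxtimes> idn n = idn (m + n)"
proof (rule rep_eqD[OF tensor_ident])
  show "rep (Node (right_comb m) (right_comb n)) (Node (right_comb m) (right_comb n))
      (\<one> (pow m \<odot> pow n)) (idn (m + n))"
    using rep_ident[of _ "Node (right_comb m) (right_comb n)"] by simp
qed (rule pow_obj rep_ident_pow rep_tensor)+

lemma tns_unit:
  assumes "arr F"
  shows "idn 0 \<boxtimes> F = F" "F \<boxtimes> idn 0 = F"
proof -
  from assms obtain f where f: "f \<in> hom C (pow (dm F)) (pow (cd F))"
    and rep: "rep (right_comb (dm F)) (right_comb (cd F)) f F"
    by (rule arr_homE)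
  have unit: "rep Unit Unit (\<one> \<I>) (idn 0)"
    using rep_ident[of \<I> Unit] by simp
  show "idn 0 \<boxtimes> F = F"
    by (rule rep_eqD[OF lunit_natural[OF f]]) (rule rep unit rep_structural obj_of_eqs rep_tensor)+
  show "F \<boxtimes> idn 0 = F"
    by (rule rep_eqD[OF runit_natural[OF f]]) (rule rep unit rep_structural obj_of_eqs rep_tensor)+
qed

lemma br_natural:
  assumes "arr F" "arr G"
  shows "br (cd F) (cd G) \<bullet> F \<boxtimes> G = G \<boxtimes> F \<bullet> br (dm F) (dm G)"
proof -
  from assms obtain f g where
    "f \<in> hom C (pow (dm F)) (pow (cd F))" "g \<in> hom C (pow (dm G)) (pow (cd G))"
    and reps: "rep (right_comb (dm F)) (right_comb (cd F)) f F"
    "rep (right_comb (dm G)) (right_comb (cd G)) g G"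
    by (meson arr_homE)
  then show ?thesis
    by (intro rep_eqD[OF braid_natural]) (assumption | rule reps rep_braid_pow rep_comp rep_tensor)+
qed

lemma br_add:
  "br l (m + n) = idn m \<boxtimes> br l n \<bullet> br l m \<boxtimes> idn n"
  "br (l + m) n = br l n \<boxtimes> idn m \<bullet> idn l \<boxtimes> br m n"
proof -
  have *: "rep (Node (right_comb l) (Node (right_comb m) (right_comb n)))
      (Node (Node (right_comb m) (right_comb n)) (right_comb l)) (\<c> (pow l) (pow m \<odot> pow n)) (br l (m + n))"
    using rep_braid[of _ "right_comb l" _ "Node (right_comb m) (right_comb n)"] by simp
  show "br l (m + n) = idn m \<boxtimes> br l n \<bullet> br l m \<boxtimes> idn n"
    by (rule rep_eqD[OF hexagon])
      (rule pow_obj * rep_ident_pow rep_braid_pow rep_structural obj_of_eqs rep_comp rep_tensor)+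
  have *: "rep (Node (Node (right_comb l) (right_comb m)) (right_comb n))
      (Node (right_comb n) (Node (right_comb l) (right_comb m))) (\<c> (pow l \<odot> pow m) (pow n)) (br (l + m) n)"
    using rep_braid[of _ "Node (right_comb l) (right_comb m)" _ "right_comb n"] by simp
  show "br (l + m) n = br l n \<boxtimes> idn m \<bullet> idn l \<boxtimes> br m n"
    by (rule rep_eqD[OF hexagon'])
      (rule pow_obj * rep_ident_pow rep_braid_pow rep_structural obj_of_eqs rep_comp rep_tensor)+
qed

lemma br_bri:
  "br m n \<bullet> bri n m = idn (n + m)" "bri n m \<bullet> br m n = idn (m + n)"
proof -
  have "rep (Node (right_comb m) (right_comb n)) (Node (right_comb m) (right_comb n))
    (\<one> (pow m \<odot> pow n)) (idn (m + n))" for m n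
    using rep_ident[of _ "Node (right_comb m) (right_comb n)"] by simp
  note * = this
  show "br m n \<bullet> bri n m = idn (n + m)"
    by (rule rep_eqD[OF arr_inv_braid(5)]) (rule pow_obj * rep_braid_pow rep_comp)+
  show "bri n m \<bullet> br m n = idn (m + n)"
    by (rule rep_eqD[OF arr_inv_braid(6)]) (rule pow_obj * rep_braid_pow rep_comp)+
qed

lemma pro_type:
  "arr (idn n)" "dm (idn n) = n" "cd (idn n) = n"
  "arr (br m n)" "dm (br m n) = m + n" "cd (br m n) = n + m"
  "arr (bri m n)" "dm (bri m n) = m + n" "cd (bri m n) = n + m"
  using rep_D[OF rep_ident_pow] rep_D[OF rep_braid_pow(1)] rep_D[OF rep_braid_pow(2)] by simp_all

lemma cmp_type:
  assumes "arr F" "arr G" "dm G = cd F"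
  shows "arr (G \<bullet> F)" "dm (G \<bullet> F) = dm F" "cd (G \<bullet> F) = cd G"
proof -
  obtain f g where "rep (right_comb (dm F)) (right_comb (cd F)) f F"
    "rep (right_comb (cd F)) (right_comb (cd G)) g G"
    using assms arr_rep by metis
  from rep_D[OF rep_comp[OF this(2,1)]]
  show "arr (G \<bullet> F)" "dm (G \<bullet> F) = dm F" "cd (G \<bullet> F) = cd G"
    by simp_all
qed

lemma tns_type:
  assumes "arr F" "arr G"
  shows "arr (F \<boxtimes> G)" "dm (F \<boxtimes> G) = dm F + dm G" "cd (F \<boxtimes> G) = cd F + cd G"
proof -
  obtain f g where "rep (right_comb (dm F)) (right_comb (cd F)) f F"
    "rep (right_comb (dm G)) (right_comb (cd G)) g G"
    using assms arr_rep by metis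
  from rep_D[OF rep_tensor[OF this]]
  show "arr (F \<boxtimes> G)" "dm (F \<boxtimes> G) = dm F + dm G" "cd (F \<boxtimes> G) = cd F + cd G"
    by simp_all
qed

lemma cmp_idn:
  assumes "arr F"
  shows "F \<bullet> idn (dm F) = F" "idn (cd F) \<bullet> F = F"
proof -
  obtain f where f: "f \<in> hom C (pow (dm F)) (pow (cd F))"
    and rep: "rep (right_comb (dm F)) (right_comb (cd F)) f F"
    using assms by (rule arr_homE)
  show "F \<bullet> idn (dm F) = F"
    by (rule rep_eqD[OF comp_ident_right[OF f]]) (rule rep rep_ident_pow rep_comp)+
  show "idn (cd F) \<bullet> F = F"
    by (rule rep_eqD[OF comp_ident_left[OF f]]) (rule rep rep_ident_pow rep_comp)+
qed

lemma braided_pro_powers: "braided_pro arr dm cd idn (\<bullet>) (\<boxtimes>) br bri"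
  by unfold_locales
    (auto simp: pro_type cmp_type tns_type cmp_assoc cmp_idn tns_assoc tns_idn tns_unit tns_cmp
      br_bri br_natural br_add)

lemma rep_eq_iff: "rep b b' f F \<Longrightarrow> rep b b' g G \<Longrightarrow> f = g \<longleftrightarrow> F = G"
  using rep_eqD[of f g b b' F G] rep_eqI[of b b' f F g G] by blast

abbreviation "pair \<equiv> Node Leaf Leaf"

lemma rep_base:
  "rep Leaf Leaf (\<one> A) (idn 1)"
  "rep pair pair (\<c> A A) (br 1 1)"
  "rep pair pair (\<c>\<^sup>- A A) (bri 1 1)"
  using rep_ident[of A Leaf] rep_braid[of A Leaf A Leaf] rep_inv_braid[of A Leaf A Leaf] by simp_all

lemma rep_homD:
  "rep pair pair t T \<Longrightarrow> t \<in> hom C (A \<odot> A) (A \<odot> A)"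
  "rep Leaf Unit e E \<Longrightarrow> e \<in> hom C A \<I>"
  by (simp_all add: rep_def)

section \<open>Transfer of multiplier bimonoids to strings and back\<close>

text \<open>Both directions are used: one brings the given bimonoid to strings, the other brings its
  opposite back.\<close>

lemma multiplier_bimonoid_iff:
  assumes reps: "rep pair pair t1 T1" "rep pair pair t2 T2" "rep Leaf Unit e E"
  shows "multiplier_bimonoid C A t1 t2 e \<longleftrightarrow>
    pro_bimonoid arr dm cd idn (\<bullet>) (\<boxtimes>) br bri T1 T2 E"
proof -
  have types: "arr T1" "dm T1 = 2" "cd T1 = 2" "arr T2" "dm T2 = 2" "cd T2 = 2"
    "arr E" "dm E = 1" "cd E = 0"
    using rep_D(4-6)[OF reps(1)] rep_D(4-6)[OF reps(2)] rep_D(4-6)[OF reps(3)] by simp_all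
  show ?thesis
    unfolding multiplier_bimonoid_def pro_bimonoid_def pro_bimonoid_axioms_def
    by (simp only: types simp_thms conj_assoc base braided_pro_powers rep_homD(1)[OF reps(1)]
        rep_homD(1)[OF reps(2)] rep_homD(2)[OF reps(3)],
        intro conj_cong rep_eq_iff)
      (rule reps rep_base rep_structural obj_of_eqs rep_comp rep_tensor)+
qed

lemma rep_mult:
  assumes reps: "rep pair pair t1 T1" "rep Leaf Unit e E"
  shows "rep pair Leaf (mult C A t1 e) (E \<boxtimes> idn 1 \<bullet> T1)"
  unfolding mult_def by (rule reps rep_base rep_structural obj_of_eqs rep_comp rep_tensor)+

lemma rep_antipode:
  assumes reps: "rep pair pair (inverse_arr C t1) U1" "rep pair pair (inverse_arr C t2) U2" "rep Leaf Unit e E"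
  shows "rep pair Leaf (antipode1 C A t1 e) (E \<boxtimes> idn 1 \<bullet> U1)"
    and "rep pair Leaf (antipode2 C A t2 e) (idn 1 \<boxtimes> E \<bullet> U2)"
  unfolding antipode1_def antipode2_def
  by (rule reps rep_base rep_structural obj_of_eqs rep_comp rep_tensor)+

end

section \<open>The antipode is a morphism\<close>

locale multiplier_bimonoid_powers = tensor_powers +
  fixes t1 t2 e
  assumes bimonoid: "multiplier_bimonoid C A t1 t2 e"
begin

abbreviation "T1 \<equiv> strict pair pair t1"
abbreviation "T2 \<equiv> strict pair pair t2"
abbreviation "E \<equiv> strict Leaf Unit e"

lemma reps: "rep pair pair t1 T1" "rep pair pair t2 T2" "rep Leaf Unit e E"
  using bimonoid by (simp_all add: multiplier_bimonoid_def rep_strict)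

sublocale strict: pro_bimonoid arr dm cd idn "(\<bullet>)" "(\<boxtimes>)" br bri T1 T2 E
  using bimonoid multiplier_bimonoid_iff[OF reps] by simp

lemma rep_op:
  "rep pair pair (\<c> A A \<cdot> t2 \<cdot> \<c>\<^sup>- A A) (br 1 1 \<bullet> T2 \<bullet> bri 1 1)"
  "rep pair pair (\<c> A A \<cdot> t1 \<cdot> \<c>\<^sup>- A A) (br 1 1 \<bullet> T1 \<bullet> bri 1 1)"
  by (rule reps rep_base rep_comp)+

lemma opposite_bimonoid:
  "multiplier_bimonoid C A (\<c> A A \<cdot> t2 \<cdot> \<c>\<^sup>- A A) (\<c> A A \<cdot> t1 \<cdot> \<c>\<^sup>- A A) e"
  using multiplier_bimonoid_iff[OF rep_op reps(3)] strict.opposite_pro_bimonoid by simp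

lemma rep_mult': "rep pair Leaf (mult C A t1 e) strict.m"
  unfolding strict.m_def by (rule rep_mult reps)+

lemma opposite_mult: "mult C A (\<c> A A \<cdot> t2 \<cdot> \<c>\<^sup>- A A) e = mult C A t1 e \<cdot> \<c>\<^sup>- A A"
  by (rule rep_eqI[OF _ _ strict.opposite_mult])
    (rule rep_mult rep_mult' reps rep_op rep_base rep_comp)+

lemma semigroup_mult: "semigroup C A (mult C A t1 e)"
proof -
  have "mult C A t1 e \<cdot> mult C A t1 e \<otimes> \<one> A
      = mult C A t1 e \<cdot> \<one> A \<otimes> mult C A t1 e \<cdot> \<a> A A A"
  proof (rule rep_eqI)
    show "strict.m \<bullet> strict.m \<boxtimes> idn 1 = strict.m \<bullet> idn 1 \<boxtimes> strict.m"
      using strict.mult_assoc by (simp add: strict.tns_idn_wh)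
  qed (rule rep_mult' rep_base rep_structural obj_of_eqs rep_comp rep_tensor)+
  then show ?thesis
    using rep_mult' by (simp add: semigroup_def rep_def)
qed

end

locale multiplier_hopf_monoid_powers = multiplier_bimonoid_powers +
  assumes iso: "iso C t1" "iso C t2"
begin

abbreviation "U1 \<equiv> strict pair pair (inverse_arr C t1)"
abbreviation "U2 \<equiv> strict pair pair (inverse_arr C t2)"

lemma reps_inverse: "rep pair pair (inverse_arr C t1) U1" "rep pair pair (inverse_arr C t2) U2"
  using reps iso by (simp_all add: rep_def hom_def)

sublocale strict: pro_hopf_monoid arr dm cd idn "(\<bullet>)" "(\<boxtimes>)" br bri T1 T2 E U1 U2
proof
  have ident: "rep pair pair (\<one> (A \<odot> A)) (idn 2)"
    using rep_ident[of "A \<odot> A" pair] by simp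
  have t: "t1 \<cdot> inverse_arr C t1 = \<one> (A \<odot> A)" "inverse_arr C t1 \<cdot> t1 = \<one> (A \<odot> A)"
    "t2 \<cdot> inverse_arr C t2 = \<one> (A \<odot> A)" "inverse_arr C t2 \<cdot> t2 = \<one> (A \<odot> A)"
    using reps iso by (simp_all add: rep_def hom_def)
  show "T1 \<bullet> U1 = idn 2" "U1 \<bullet> T1 = idn 2" "T2 \<bullet> U2 = idn 2" "U2 \<bullet> T2 = idn 2"
    by (rule t[THEN rep_eqD] ident reps reps_inverse rep_comp)+
qed (use rep_D[OF reps_inverse(1)] rep_D[OF reps_inverse(2)] in simp_all)

abbreviation (input) "s1 \<equiv> antipode1 C A t1 e"
abbreviation (input) "s2 \<equiv> antipode2 C A t2 e"

lemma rep_antipode': "rep pair Leaf s1 strict.s1" "rep pair Leaf s2 strict.s2"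
  unfolding strict.s1_def strict.s2_def using rep_antipode[OF reps_inverse reps(3)] by simp_all

text \<open>The counit and comultiplicativity axioms for the second component of the antipode are
  those for the first one in the mirror image.\<close>

interpretation reverse: pro_hopf_monoid arr dm cd idn "(\<bullet>)" "\<lambda>f g. g \<boxtimes> f"
  "\<lambda>m n. br n m" "\<lambda>m n. bri n m" T2 T1 E U2 U1
  by (rule strict.reverse_pro_hopf_monoid)

lemma reverse_antipode: "reverse.s1 = strict.s2"
  by (simp add: reverse.s1_def strict.s2_def)

lemmas rep_rules = rep_antipode' rep_mult' reps rep_base rep_structural obj_of_eqs rep_comp rep_tensor

lemma antipode_M_morphism:
  "mult C A t1 e \<cdot> \<one> A \<otimes> s1 \<cdot> \<a> A A A = mult C A t1 e \<cdot> s2 \<otimes> \<one> A"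
  by (rule rep_eqI[OF _ _ strict.antipode_M_morphism]) (rule rep_rules)+

lemma antipode_multiplicative:
  "s1 \<cdot> \<one> A \<otimes> s1 \<cdot> \<a> A A A = s1 \<cdot> (mult C A t1 e \<cdot> \<c>\<^sup>- A A) \<otimes> \<one> A"
  by (rule rep_eqI[OF _ _ strict.antipode_antimultiplicative]) (rule rep_rules)+

lemma antipode_counit:
  "e \<cdot> s1 = \<l> \<I> \<cdot> e \<otimes> e" "e \<cdot> s2 = \<l> \<I> \<cdot> e \<otimes> e"
  by (rule rep_eqI[OF _ _ strict.counit_s1] rep_eqI[OF _ _ reverse.counit_s1[unfolded reverse_antipode]],
      (rule rep_rules)+)+

lemma antipode_comultiplicative:
  "s1 \<otimes> \<one> A \<cdot> \<a>\<^sup>- A A A \<cdot> \<one> A \<otimes> t1 \<cdot> \<one> A \<otimes> (s1 \<otimes> \<one> A) \<cdot>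
      \<one> A \<otimes> \<a>\<^sup>- A A A \<cdot> \<a> A A (A \<odot> A)
    = s1 \<otimes> s1 \<cdot> mid_braid C A A A A \<cdot> (\<c> A A \<cdot> t1 \<cdot> \<c>\<^sup>- A A) \<otimes> t1"
  unfolding mid_braid_def
  by (rule rep_eqI[OF _ _ strict.antipode_comultiplicative]) (rule rep_rules)+

lemma antipode_comultiplicative':
  "\<one> A \<otimes> s2 \<cdot> \<a> A A A \<cdot> t2 \<otimes> \<one> A \<cdot> \<a>\<^sup>- A A A \<cdot> \<one> A \<otimes> (s2 \<otimes> \<one> A) \<cdot>
      \<one> A \<otimes> \<a>\<^sup>- A A A \<cdot> \<a> A A (A \<odot> A)
    = s2 \<otimes> s2 \<cdot> mid_braid C A A A A \<cdot> t2 \<otimes> (\<c> A A \<cdot> t2 \<cdot> \<c>\<^sup>- A A)"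
proof (rule rep_eqI)
  \<comment> \<open>The reflection also reverses the bracketing of threefold tensor products, which
    \<open>strict.tns_assoc\<close> repairs.\<close>
  show "idn 1 \<boxtimes> strict.s2 \<bullet> T2 \<boxtimes> idn 1 \<bullet> idn 1 \<boxtimes> (strict.s2 \<boxtimes> idn 1)
      = strict.s2 \<boxtimes> strict.s2 \<bullet> idn 1 \<boxtimes> (br 1 1 \<boxtimes> idn 1) \<bullet> T2 \<boxtimes> (br 1 1 \<bullet> T2 \<bullet> bri 1 1)"
    using reverse.antipode_comultiplicative by (simp add: reverse_antipode strict.tns_assoc)
qed (unfold mid_braid_def, (rule rep_rules)+)

end

theorem theorem3p12:
  fixes C :: "('o, 'm) braided_monoidal_category" (structure)
    and Q :: "'m set" and A :: 'o and t1 t2 e :: 'm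
  assumes "braided_monoidal_category C"
    and "regular_epi_class C Q"
    and "multiplier_hopf_monoid C A t1 t2 e"
    and "nondegenerate C A (mult C A t1 e)"
    and "e \<in> Q"
  shows "bimonoid_morphism C Q
           A (\<c> A A \<cdot> t2 \<cdot> \<c>\<^sup>- A A) (\<c> A A \<cdot> t1 \<cdot> \<c>\<^sup>- A A) e
           A t1 t2 e
           (antipode1 C A t1 e) (antipode2 C A t2 e)"
proof -
  interpret braided_monoidal_category C by fact
  interpret Q: regular_epi_class C Q by fact
  have bimonoid: "multiplier_bimonoid C A t1 t2 e" and iso [simp]: "iso C t1" "iso C t2"
    using assms(3) by (simp_all add: multiplier_hopf_monoid_def)
  then have A [simp]: "A \<in> Obj C" and homs: "t1 \<in> hom C (A \<odot> A) (A \<odot> A)"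
      "t2 \<in> hom C (A \<odot> A) (A \<odot> A)" "e \<in> hom C A \<I>"
    by (simp_all add: multiplier_bimonoid_def)
  note [simp] = homs[THEN homD(1)] homs[THEN homD(2)] homs[THEN homD(3)]
  interpret multiplier_hopf_monoid_powers C A t1 t2 e
    using bimonoid by unfold_locales simp_all
  interpret opposite: multiplier_bimonoid_powers C A "\<c> A A \<cdot> t2 \<cdot> \<c>\<^sup>- A A" "\<c> A A \<cdot> t1 \<cdot> \<c>\<^sup>- A A" e
    using opposite_bimonoid by unfold_locales
  \<comment> \<open>All density claims come from these two. As \<open>t1\<close> and
    \<open>t2\<close> are invertible, the multiplication and the antipode components are composites
    of these arrows with isomorphisms, and \<open>d1\<close> and \<open>d2\<close> are composites of
    the whiskered multiplication with isomorphisms.\<close>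
  have e_tensor: "e \<otimes> \<one> A \<in> Q" "\<one> A \<otimes> e \<in> Q"
    using \<open>e \<in> Q\<close> by (simp_all add: Q.tensor_closed Q.isos)
  have admissible: "admissible_bimonoid C Q A t1' t2' e"
    if bim: "multiplier_bimonoid C A t1' t2' e" and nd: "nondegenerate C A (mult C A t1' e)"
      and iso' [simp]: "iso C t1'" "iso C t2'" for t1' t2'
  proof -
    have [simp]: "t1' \<in> Arr C" "Dom C t1' = A \<odot> A" "Cod C t1' = A \<odot> A"
      "t2' \<in> Arr C" "Dom C t2' = A \<odot> A" "Cod C t2' = A \<odot> A"
      using bim by (simp_all add: multiplier_bimonoid_def hom_def)
    have mult: "mult C A t1' e \<in> Q"
      using e_tensor(1) unfolding mult_def by (intro Q.comp_closed) (simp_all add: Q.isos)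
    have [simp]: "mult C A t1' e \<in> Arr C" "Dom C (mult C A t1' e) = A \<odot> A" "Cod C (mult C A t1' e) = A"
      by (simp_all add: mult_def)
    have mult_tensor: "mult C A t1' e \<otimes> \<one> A \<in> Q" "\<one> A \<otimes> mult C A t1' e \<in> Q"
      using mult by (simp_all add: Q.tensor_closed Q.isos)
    have "d1 C A t1' e \<in> Q"
      unfolding d1_def by (rule Q.comp_closed[OF Q.isos mult_tensor(1)]) simp_all
    moreover have "d2 C A t1' t2' e \<in> Q"
      unfolding d2_def by (rule Q.comp_closed[OF Q.isos mult_tensor(2)]) simp_all
    ultimately show ?thesis
      using bim nd mult \<open>e \<in> Q\<close> by (simp add: admissible_bimonoid_def)
  qed
  have semigroup: "semigroup C A (mult C A t1 e)"
    by (rule semigroup_mult)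
  have nondegenerate_op: "nondegenerate C A (mult C A (\<c> A A \<cdot> t2 \<cdot> \<c>\<^sup>- A A) e)"
    using nondegenerate_opposite[OF A _ assms(4)] semigroup
    by (simp add: opposite_mult semigroup_def)
  have M: "M_morphism C A A (mult C A t1 e) (antipode1 C A t1 e) (antipode2 C A t2 e)"
    using semigroup assms(4) antipode_M_morphism
    by (simp add: M_morphism_def antipode1_def antipode2_def hom_def)
  have "antipode1 C A t1 e \<in> Q" "antipode2 C A t2 e \<in> Q"
    using e_tensor unfolding antipode1_def antipode2_def
    by (auto intro!: Q.comp_closed simp: Q.isos)
  with M have "dense_M_morphism C Q A A (mult C A t1 e) (antipode1 C A t1 e) (antipode2 C A t2 e)"
    by (simp add: dense_M_morphism_def)
  \<comment> \<open>The multiplication of the source is that of the target after the inverse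
    braiding, so antimultiplicativity of the antipode becomes multiplicativity.\<close>
  moreover have "multiplicative_M_morphism C A (mult C A (\<c> A A \<cdot> t2 \<cdot> \<c>\<^sup>- A A) e) A (mult C A t1 e)
      (antipode1 C A t1 e) (antipode2 C A t2 e)"
    using opposite.semigroup_mult M antipode_multiplicative
    by (simp only: multiplicative_M_morphism_def opposite_mult simp_thms)
  moreover have "admissible_bimonoid C Q A t1 t2 e"
    using bimonoid assms(4) by (intro admissible) simp_all
  moreover have "admissible_bimonoid C Q A (\<c> A A \<cdot> t2 \<cdot> \<c>\<^sup>- A A) (\<c> A A \<cdot> t1 \<cdot> \<c>\<^sup>- A A) e"
    using opposite_bimonoid nondegenerate_op by (intro admissible) simp_all
  ultimately show ?thesis
    unfolding bimonoid_morphism_def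
    using antipode_counit antipode_comultiplicative antipode_comultiplicative' by blast
qed

end
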